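(* Let $N\ge2$ and let $\Omega\subset\mathbb R^N$ be a bounded strictly convex domain. Then there exists a function $\psi_1\in C(\overline\Omega)$ such that $$\mathcal P_1^+(D^2\psi_1)+\mu_1^+\psi_1=0,\quad \psi_1>0\ \text{ in }\Omega,\qquad \psi_1=0\ \text{ on }\partial\Omega.$$
   Context: $\mathcal P_1^+(X)=\lambda_N(X)$ is the largest eigenvalue of the symmetric $N\times N$ matrix $X$. A domain is a nonempty open connected set; $\Omega$ is strictly convex if $(1-t)x+ty\in\Omega$ for all $x\neq y$ in $\overline\Omega$ and $0<t<1$. $\mathrm{LSC}(\Omega)$ is the set of real-valued lower semicontinuous functions on $\Omega$. Define $$\mu_1^+=\sup\{\mu\in\mathbb R:\exists\,\varphi\in\mathrm{LSC}(\Omega),\ \varphi>0,\ \mathcal P_1^+(D^2\varphi)+\mu\varphi\le0\ \text{in }\Omega\},$$ which is finite. All equations and inequalities are in the viscosity sense: $u$ upper (resp. lower) semicontinuous satisfies $\mathcal P_1^+(D^2u)+\mu u\ge 0$ (resp. $\le 0$) if whenever $\varphi$ is $C^2$ near $x_0\in\Omega$ and $u-\varphi$ has a local maximum (resp. minimum) at $x_0$, then $\mathcal P_1^+(D^2\varphi(x_0))+\mu u(x_0)\ge 0$ (resp. $\le 0$); a solution is a continuous function satisfying both. *)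

theory Defs
  imports "HOL-Analysis.Analysis"
begin

definition strictly_convex :: "'a::real_normed_vector set \<Rightarrow> bool" where
  "strictly_convex S \<longleftrightarrow>
     (\<forall>x\<in>closure S. \<forall>y\<in>closure S. \<forall>t::real.
        x \<noteq> y \<longrightarrow> 0 < t \<longrightarrow> t < 1 \<longrightarrow> (1 - t) *\<^sub>R x + t *\<^sub>R y \<in> S)"

definition lsc_on :: "'a::topological_space set \<Rightarrow> ('a \<Rightarrow> real) \<Rightarrow> bool" where
  "lsc_on S u \<longleftrightarrow> (\<forall>x\<in>S. \<forall>a < u x. eventually (\<lambda>y. a < u y) (at x within S))"

definition usc_on :: "'a::topological_space set \<Rightarrow> ('a \<Rightarrow> real) \<Rightarrow> bool" where
  "usc_on S u \<longleftrightarrow> (\<forall>x\<in>S. \<forall>a > u x. eventually (\<lambda>y. u y < a) (at x within S))"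

definition gradient :: "(real^'n \<Rightarrow> real) \<Rightarrow> real^'n \<Rightarrow> real^'n" where
  "gradient f x = (\<chi> i. frechet_derivative f (at x) (axis i 1))"

definition hessian :: "(real^'n \<Rightarrow> real) \<Rightarrow> real^'n \<Rightarrow> real^'n^'n" where
  "hessian f x = matrix (frechet_derivative (gradient f) (at x))"

definition C2_near :: "(real^'n \<Rightarrow> real) \<Rightarrow> real^'n \<Rightarrow> bool" where
  "C2_near f x0 \<longleftrightarrow>
     (\<exists>U. open U \<and> x0 \<in> U \<and> f differentiable_on U \<and>
          gradient f differentiable_on U \<and> continuous_on U (hessian f))"

text \<open>The largest eigenvalue. A real square matrix has finitely many eigenvalues, and a symmetric
  one has at least one, so the maximum is meaningful for symmetric matrices, in particular for
  the Hessian at a point near which the function is twice continuously differentiable.\<close>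

definition P1_plus :: "real^'n^'n \<Rightarrow> real" where
  "P1_plus X = Max {e. \<exists>v. v \<noteq> 0 \<and> X *v v = e *\<^sub>R v}"

definition visc_subsolution :: "(real^'n) set \<Rightarrow> real \<Rightarrow> (real^'n \<Rightarrow> real) \<Rightarrow> bool" where
  "visc_subsolution \<Omega> \<mu> u \<longleftrightarrow> usc_on \<Omega> u \<and>
     (\<forall>x0\<in>\<Omega>. \<forall>\<phi>. C2_near \<phi> x0 \<longrightarrow>
        eventually (\<lambda>x. u x - \<phi> x \<le> u x0 - \<phi> x0) (at x0 within \<Omega>) \<longrightarrow>
        P1_plus (hessian \<phi> x0) + \<mu> * u x0 \<ge> 0)"

definition visc_supersolution :: "(real^'n) set \<Rightarrow> real \<Rightarrow> (real^'n \<Rightarrow> real) \<Rightarrow> bool" where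
  "visc_supersolution \<Omega> \<mu> u \<longleftrightarrow> lsc_on \<Omega> u \<and>
     (\<forall>x0\<in>\<Omega>. \<forall>\<phi>. C2_near \<phi> x0 \<longrightarrow>
        eventually (\<lambda>x. u x - \<phi> x \<ge> u x0 - \<phi> x0) (at x0 within \<Omega>) \<longrightarrow>
        P1_plus (hessian \<phi> x0) + \<mu> * u x0 \<le> 0)"

definition visc_solution :: "(real^'n) set \<Rightarrow> real \<Rightarrow> (real^'n \<Rightarrow> real) \<Rightarrow> bool" where
  "visc_solution \<Omega> \<mu> u \<longleftrightarrow>
     continuous_on \<Omega> u \<and> visc_subsolution \<Omega> \<mu> u \<and> visc_supersolution \<Omega> \<mu> u"

text \<open>The supremum is taken in the reals: for a nonempty bounded open set the set below contains
  0 (witnessed by a positive constant) and is bounded above.\<close>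

definition mu1_plus :: "(real^'n) set \<Rightarrow> real" where
  "mu1_plus \<Omega> = Sup {\<mu>. \<exists>\<phi>. (\<forall>x\<in>\<Omega>. \<phi> x > 0) \<and> visc_supersolution \<Omega> \<mu> \<phi>}"

end

theory Submission
  imports Defs "HOL-Complex_Analysis.Great_Picard"
begin

text \<open>A positive supersolution for \<open>\<mu> \<ge> 0\<close> is the same as a continuous function that is a
  supersolution of the one-dimensional equation \<open>v'' + \<mu> v = 0\<close> along every chord; in particular it
  is concave, and infima and limits of such functions are again of this kind. For \<open>\<mu> < \<mu>\<^sub>1\<close> there is
  therefore a least nonnegative supersolution \<open>u\<close> of \<open>\<lambda>\<^sub>N(D\<^sup>2u) + \<mu> u = -1\<close>, which is small near the
  boundary because strict convexity provides barriers. Put \<open>v = u / (1 + sup u)\<close> and let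
  \<open>\<mu> \<rightarrow> \<mu>\<^sub>1\<close>. By Arzela-Ascoli the \<open>v\<close> converge along a sequence to a supersolution \<open>\<psi>\<close> for a
  right-hand side \<open>-\<gamma>\<close>. If \<open>\<gamma> > 0\<close>, then \<open>\<psi>\<close> would be admissible for a parameter above
  \<open>\<mu>\<^sub>1\<close>; so \<open>\<gamma> = 0\<close> and \<open>sup \<psi> = 1\<close>. If \<open>\<psi>\<close> failed to be a subsolution at a point,
  lowering the functions \<open>v\<close> near that point would contradict their minimality.\<close>

section \<open>Largest eigenvalue and second-order test functions\<close>

text \<open>Minimality cannot be used at \<open>mu1_plus\<close> itself: for right-hand side 0 the
  least nonnegative supersolution is the zero function. Hence the detour through
  \<open>\<mu> < mu1_plus \<Omega>\<close> and right-hand side -1, and hence the subsolution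
  property of the limit is obtained by perturbing the approximating functions, not the limit. The
  perturbation survives because a failed subsolution test leaves a strict margin, which absorbs both
  the Taylor error and the distance to the limit. No boundary condition is imposed on the
  competitors; vanishing at the boundary is a consequence of minimality, since cutting a competitor
  off at a barrier yields another competitor. Dividing by 1 + sup u, and not by sup u, keeps both
  the functions and the right-hand sides in [0,1], so that bounded and unbounded sup u need no
  separate treatment. A positive limit \<open>\<gamma>\<close> is the bounded case: as the limit is
  at most 1, \<open>\<gamma>\<close> dominates \<open>\<gamma>\<close> times the limit and can be
  moved into the parameter.\<close>

lemma symmetric_eigenvectors_orthogonal:
  fixes A :: "real^'n^'n"
  assumes "\<And>u w. u \<bullet> (A *v w) = w \<bullet> (A *v u)"
    and "A *v x = a *\<^sub>R x" and "A *v y = b *\<^sub>R y" and "a \<noteq> b"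
  shows "x \<bullet> y = 0"
proof -
  have "b * (x \<bullet> y) = a * (x \<bullet> y)"
    using assms(1)[of x y] assms(2,3) by (simp add: inner_commute)
  then show ?thesis using \<open>a \<noteq> b\<close> by simp
qed

text \<open>One eigenvector per eigenvalue gives pairwise orthogonal nonzero vectors, an independent
  and so finite family. Finiteness makes the \<open>Max\<close> in \<open>P1_plus\<close> a genuine
  maximum.\<close>

lemma finite_eigenvalues_symmetric:
  fixes A :: "real^'n^'n"
  assumes sym: "\<And>u w. u \<bullet> (A *v w) = w \<bullet> (A *v u)"
  shows "finite {e. \<exists>v. v \<noteq> 0 \<and> A *v v = e *\<^sub>R v}" (is "finite ?E")
proof -
  obtain f where f: "\<And>e. e \<in> ?E \<Longrightarrow> f e \<noteq> 0 \<and> A *v f e = e *\<^sub>R f e"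
    using bchoice[of ?E "\<lambda>e v. v \<noteq> 0 \<and> A *v v = e *\<^sub>R v"] by auto
  have orth: "f a \<bullet> f b = 0" if "a \<in> ?E" "b \<in> ?E" "a \<noteq> b" for a b
    by (rule symmetric_eigenvectors_orthogonal[OF sym, of _ a _ b]) (use f that in simp_all)
  have "inj_on f ?E"
  proof (rule inj_onI, rule ccontr)
    fix a b assume ab: "a \<in> ?E" "b \<in> ?E" "f a = f b" "a \<noteq> b"
    then have "f b \<bullet> f b = 0" using orth[of a b] by simp
    then show False using f[OF ab(2)] by simp
  qed
  moreover have "pairwise orthogonal (f ` ?E)"
    using orth by (auto simp: pairwise_def orthogonal_def)
  then have "independent (f ` ?E)"
    by (rule pairwise_orthogonal_independent) (use f in \<open>metis (no_types, lifting) imageE\<close>)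
  then have "finite (f ` ?E)" by (rule independent_imp_finite)
  ultimately show ?thesis using finite_imageD by blast
qed

text \<open>Rayleigh quotient: a maximizer v of the quadratic form on the unit sphere is an
  eigenvector. The residual \<open>w\<close> must vanish, for otherwise moving v slightly along - w
  would violate the maximality.\<close>

lemma P1_plus_symmetric:
  fixes A :: "real^'n^'n"
  assumes sym: "\<And>u w. u \<bullet> (A *v w) = w \<bullet> (A *v u)"
  shows P1_plus_eigenvalue: "\<exists>v. v \<noteq> 0 \<and> A *v v = P1_plus A *\<^sub>R v"
    and inner_le_P1_plus: "x \<bullet> (A *v x) \<le> P1_plus A * (norm x)\<^sup>2"
    and eigenvalue_le_P1_plus: "v \<noteq> 0 \<Longrightarrow> A *v v = e *\<^sub>R v \<Longrightarrow> e \<le> P1_plus A"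
proof -
  let ?E = "{e. \<exists>v. v \<noteq> 0 \<and> A *v v = e *\<^sub>R v}"
  have fin: "finite ?E" by (rule finite_eigenvalues_symmetric[OF sym])
  have "continuous_on (sphere 0 1) (\<lambda>x. x \<bullet> (A *v x))"
    by (intro continuous_intros matrix_vector_mult_linear_continuous_on)
  moreover have "sphere (0::real^'n) 1 \<noteq> {}" by simp
  ultimately obtain v where v: "norm v = 1"
      and max: "\<And>y. norm y = 1 \<Longrightarrow> y \<bullet> (A *v y) \<le> v \<bullet> (A *v v)"
    using continuous_attains_sup[OF compact_sphere[of "0::real^'n" 1], of "\<lambda>x. x \<bullet> (A *v x)"] by auto
  define l where "l = v \<bullet> (A *v v)"
  have le: "y \<bullet> (A *v y) \<le> l * (norm y)\<^sup>2" for y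
  proof (cases "y = 0")
    case False
    have "(y /\<^sub>R norm y) \<bullet> (A *v (y /\<^sub>R norm y)) \<le> l"
      unfolding l_def by (rule max) (use False in simp)
    then have "(y \<bullet> (A *v y)) / (norm y)\<^sup>2 \<le> l"
      by (simp add: matrix_vector_mult_scaleR power2_eq_square divide_inverse algebra_simps)
    then show ?thesis using False by (simp add: field_simps)
  qed simp
  define w where "w = l *\<^sub>R v - A *v v"
  define B where "B = l * (norm w)\<^sup>2 - w \<bullet> (A *v w)"
  have ineq: "0 \<le> 2 * t * (w \<bullet> w) + t\<^sup>2 * B" for t
  proof -
    have 1: "(v + t *\<^sub>R w) \<bullet> (A *v (v + t *\<^sub>R w))
        = l + 2 * t * (w \<bullet> (A *v v)) + t\<^sup>2 * (w \<bullet> (A *v w))"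
      using sym[of v w]
      by (simp add: matrix_vector_right_distrib matrix_vector_mult_scaleR inner_add_left inner_add_right
          l_def power2_eq_square algebra_simps)
    have 2: "(norm (v + t *\<^sub>R w))\<^sup>2 = 1 + 2 * t * (w \<bullet> v) + t\<^sup>2 * (norm w)\<^sup>2"
      unfolding power2_norm_eq_inner using v
      by (simp add: inner_add_left inner_add_right inner_commute
          power2_eq_square algebra_simps norm_eq_1)
    have 3: "w \<bullet> w = l * (w \<bullet> v) - w \<bullet> (A *v v)"
      by (subst (2) w_def) (simp add: inner_diff_right)
    show ?thesis
      using le[of "v + t *\<^sub>R w"] unfolding 1 2 3 B_def by (simp add: algebra_simps)
  qed
  have "w = 0"
  proof (rule ccontr)
    assume "w \<noteq> 0"
    then have c: "w \<bullet> w > 0" by simp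
    \<comment> \<open>So small that \<open>\<bar>t * B\<bar>\<close> is at most
      \<open>w \<bullet> w\<close>: the linear term then wins, and it is negative.\<close>
    define t where "t = - (w \<bullet> w) / (\<bar>B\<bar> + 1)"
    have t: "t < 0" using c unfolding t_def by (simp add: divide_neg_pos)
    have "- t * \<bar>B\<bar> \<le> w \<bullet> w"
      using c unfolding t_def by (simp add: field_simps)
    then have "- t * B \<le> w \<bullet> w" using t
      by (smt (verit) mult_left_mono)
    then have "2 * (w \<bullet> w) + t * B > 0" using c by linarith
    then have "t * (2 * (w \<bullet> w) + t * B) < 0" using t by (simp add: mult_neg_pos)
    then show False using ineq[of t] by (simp add: algebra_simps power2_eq_square)
  qed
  then have "A *v v = l *\<^sub>R v" unfolding w_def by simp
  moreover have "v \<noteq> 0" using v by auto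
  ultimately have l: "l \<in> ?E" by blast
  have ub: "e \<le> l" if e: "e \<in> ?E" for e
  proof -
    obtain y where y: "y \<noteq> 0" "A *v y = e *\<^sub>R y" using e by auto
    have "e * (norm y)\<^sup>2 \<le> l * (norm y)\<^sup>2"
      using le[of y] unfolding y(2) power2_norm_eq_inner by simp
    then show ?thesis using y(1) by simp
  qed
  have P: "P1_plus A = l" unfolding P1_plus_def by (rule Max_eqI[OF fin ub l])
  show "\<exists>v. v \<noteq> 0 \<and> A *v v = P1_plus A *\<^sub>R v" using l P by simp
  show "x \<bullet> (A *v x) \<le> P1_plus A * (norm x)\<^sup>2" using le P by simp
  show "v \<noteq> 0 \<Longrightarrow> A *v v = e *\<^sub>R v \<Longrightarrow> e \<le> P1_plus A" for v using ub P by auto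
qed

section \<open>Second-order expansion at a point and symmetry of the Hessian\<close>

lemma has_derivative_gradient:
  assumes "f differentiable (at x)"
  shows "(f has_derivative (\<lambda>h. gradient f x \<bullet> h)) (at x)"
proof -
  have d: "(f has_derivative frechet_derivative f (at x)) (at x)"
    using assms by (simp add: frechet_derivative_works)
  interpret bounded_linear "frechet_derivative f (at x)"
    using d by (rule has_derivative_bounded_linear)
  have "frechet_derivative f (at x) h = gradient f x \<bullet> h" for h
  proof -
    have "frechet_derivative f (at x) h = frechet_derivative f (at x) (\<Sum>i\<in>UNIV. h $ i *\<^sub>R axis i 1)"
      by (simp add: basis_expansion scalar_mult_eq_scaleR[symmetric])
    also have "\<dots> = (\<Sum>i\<in>UNIV. h $ i * frechet_derivative f (at x) (axis i 1))"
      by (simp add: sum scaleR)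
    finally show ?thesis by (simp add: gradient_def inner_vec_def mult.commute)
  qed
  then have "frechet_derivative f (at x) = (\<lambda>h. gradient f x \<bullet> h)" by blast
  then show ?thesis using d by simp
qed

lemma has_derivative_hessian:
  assumes "gradient f differentiable (at x)"
  shows "(gradient f has_derivative (\<lambda>h. hessian f x *v h)) (at x)"
proof -
  have d: "(gradient f has_derivative frechet_derivative (gradient f) (at x)) (at x)"
    using assms by (simp add: frechet_derivative_works)
  then have "bounded_linear (frechet_derivative (gradient f) (at x))"
    by (rule has_derivative_bounded_linear)
  then show ?thesis using d by (simp add: hessian_def)
qed

lemma gradient_eqI:
  assumes "(f has_derivative (\<lambda>h. p \<bullet> h)) (at x)"
  shows "gradient f x = p"
  by (simp add: gradient_def vec_eq_iff inner_axis flip: frechet_derivative_at[OF assms])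

lemma C2_near_derivatives:
  assumes "C2_near f x"
  obtains r where "r > 0"
    "\<And>y. y \<in> ball x r \<Longrightarrow> (f has_derivative (\<lambda>h. gradient f y \<bullet> h)) (at y)"
    "(gradient f has_derivative (\<lambda>h. hessian f x *v h)) (at x)"
proof -
  obtain U where U: "open U" "x \<in> U" "f differentiable_on U" "gradient f differentiable_on U"
    using assms unfolding C2_near_def by blast
  obtain r where "r > 0" "ball x r \<subseteq> U" using U openE by blast
  moreover have "f differentiable (at y)" if "y \<in> U" for y
    using U that by (simp add: differentiable_on_eq_differentiable_at)
  moreover have "gradient f differentiable (at x)"
    using U by (simp add: differentiable_on_eq_differentiable_at)
  ultimately show thesis
    by (intro that[of r] has_derivative_gradient has_derivative_hessian) blast+
qed

lemma gradient_increment_small: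
  assumes g: "(g has_derivative (\<lambda>h. A *v h)) (at (x::real^'n))" and "\<epsilon> > 0"
  obtains r where "r > 0" "\<And>h. norm h < r \<Longrightarrow> norm (g (x + h) - g x - A *v h) \<le> \<epsilon> * norm h"
proof -
  obtain d where d: "d > 0" "\<And>y. norm (y - x) < d \<Longrightarrow> norm (g y - g x - A *v (y - x)) \<le> \<epsilon> * norm (y - x)"
    using g \<open>\<epsilon> > 0\<close> unfolding has_derivative_at_alt by blast
  show thesis using d(2)[of "x + _"] by (intro that[OF d(1)]) auto
qed

text \<open>Peano form. Along the segment from x to x + h the linear and quadratic terms are
  subtracted; the derivative \<open>D\<close> of what remains is the first-order remainder of the
  gradient paired with h, and the mean value theorem finishes.\<close>

lemma second_order_Taylor:
  assumes "C2_near f x" and "\<epsilon> > 0"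
  obtains r where "r > 0"
    "\<And>h. norm h < r \<Longrightarrow>
      \<bar>f (x + h) - f x - gradient f x \<bullet> h - (h \<bullet> (hessian f x *v h)) / 2\<bar> \<le> \<epsilon> * (norm h)\<^sup>2"
proof -
  obtain r0 where r0: "r0 > 0"
    "\<And>y. y \<in> ball x r0 \<Longrightarrow> (f has_derivative (\<lambda>h. gradient f y \<bullet> h)) (at y)"
    "(gradient f has_derivative (\<lambda>h. hessian f x *v h)) (at x)"
    using C2_near_derivatives[OF assms(1)] by blast
  obtain r1 where r1: "r1 > 0" "\<And>h. norm h < r1 \<Longrightarrow>
      norm (gradient f (x + h) - gradient f x - hessian f x *v h) \<le> \<epsilon> * norm h"
    using gradient_increment_small[OF r0(3) assms(2)] by blast
  show thesis
  proof (rule that[of "min r0 r1"])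
    show "min r0 r1 > 0" using r0 r1 by simp
    fix h :: "real^'a" assume h: "norm h < min r0 r1"
    define G where "G t = f (x + t *\<^sub>R h) - t * (gradient f x \<bullet> h) - t\<^sup>2 / 2 * (h \<bullet> (hessian f x *v h))" for t
    define D where "D t = (gradient f (x + t *\<^sub>R h) - gradient f x - hessian f x *v (t *\<^sub>R h)) \<bullet> h" for t
    have small: "norm (t *\<^sub>R h) < min r0 r1" if "0 \<le> t" "t \<le> 1" for t
      using that h by (smt (verit) mult_left_le_one_le norm_ge_zero norm_scaleR real_norm_def)
    have "(G has_derivative (\<lambda>s. s * D t)) (at t within {0..1})" if "0 \<le> t" "t \<le> 1" for t
    proof -
      have "x + t *\<^sub>R h \<in> ball x r0" using small[OF that] by (simp add: dist_norm)
      then have *: "(f has_derivative (\<lambda>h'. gradient f (x + t *\<^sub>R h) \<bullet> h')) (at (x + t *\<^sub>R h))"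
        by (rule r0)
      have "((\<lambda>t. f (x + t *\<^sub>R h)) has_derivative (\<lambda>s. gradient f (x + t *\<^sub>R h) \<bullet> (s *\<^sub>R h))) (at t within {0..1})"
        by (rule has_derivative_compose[of "\<lambda>t. x + t *\<^sub>R h", OF _ *])
           (auto intro!: derivative_eq_intros)
      then show ?thesis unfolding G_def
        by (rule has_derivative_eq_rhs[OF has_derivative_diff[OF has_derivative_diff]])
           (auto intro!: derivative_eq_intros simp: D_def fun_eq_iff inner_diff_left inner_commute
             matrix_vector_mult_scaleR algebra_simps power2_eq_square)
    qed
    then obtain t where t: "t \<in> {0..1}" "G 1 - G 0 = D t"
      using mvt_very_simple[of 0 1 G "\<lambda>t s. s * D t"] by auto
    have th: "norm (t *\<^sub>R h) \<le> norm h" using t by (simp add: mult_left_le_one_le)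
    have "\<bar>D t\<bar> \<le> norm (gradient f (x + t *\<^sub>R h) - gradient f x - hessian f x *v (t *\<^sub>R h)) * norm h"
      unfolding D_def by (rule Cauchy_Schwarz_ineq2)
    also have "\<dots> \<le> (\<epsilon> * norm (t *\<^sub>R h)) * norm h"
      by (rule mult_right_mono[OF r1(2)]) (use small[of t] t in auto)
    also have "\<dots> \<le> (\<epsilon> * norm h) * norm h"
      using th assms(2) by (intro mult_right_mono mult_left_mono) auto
    finally have "\<bar>D t\<bar> \<le> \<epsilon> * (norm h)\<^sup>2" by (simp add: power2_eq_square)
    moreover have "G 1 - G 0 = f (x + h) - f x - gradient f x \<bullet> h - (h \<bullet> (hessian f x *v h)) / 2"
      by (simp add: G_def)
    ultimately show "\<bar>f (x + h) - f x - gradient f x \<bullet> h - (h \<bullet> (hessian f x *v h)) / 2\<bar> \<le> \<epsilon> * (norm h)\<^sup>2"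
      using t by simp
  qed
qed

text \<open>The mixed difference of \<open>f\<close> over the parallelogram spanned by \<open>s u\<close> and \<open>s w\<close> is symmetric
  in \<open>u\<close> and \<open>w\<close>, and equals \<open>s\<^sup>2 u \<bullet> H w + o(s\<^sup>2)\<close>.\<close>

lemma mixed_difference_approx:
  assumes "C2_near f x" and "\<epsilon> > 0"
  obtains r where "r > 0"
    "\<And>s. 0 < s \<Longrightarrow> s < r \<Longrightarrow>
      \<bar>f (x + s *\<^sub>R u + s *\<^sub>R w) - f (x + s *\<^sub>R u) - f (x + s *\<^sub>R w) + f x
        - s\<^sup>2 * (u \<bullet> (hessian f x *v w))\<bar> \<le> \<epsilon> * s\<^sup>2"
proof -
  obtain r0 where r0: "r0 > 0"
    "\<And>y. y \<in> ball x r0 \<Longrightarrow> (f has_derivative (\<lambda>h. gradient f y \<bullet> h)) (at y)"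
    "(gradient f has_derivative (\<lambda>h. hessian f x *v h)) (at x)"
    using C2_near_derivatives[OF assms(1)] by blast
  \<comment> \<open>\<open>K\<close> bounds \<open>norm u\<close>, and \<open>s * K\<close> bounds
    all displacements from x below. The two gradient remainders contribute
    \<open>2 * e * s * K\<close>, and pairing with u costs another \<open>K\<close>; this fixes
    \<open>e\<close>.\<close>
  define K where "K = norm u + norm w + 1"
  have K: "K > 0" unfolding K_def by (simp add: add_nonneg_pos)
  define e where "e = \<epsilon> / (2 * K * K)"
  have e: "e > 0" using K assms(2) unfolding e_def by simp
  obtain r1 where r1: "r1 > 0" "\<And>h. norm h < r1 \<Longrightarrow>
      norm (gradient f (x + h) - gradient f x - hessian f x *v h) \<le> e * norm h"
    using gradient_increment_small[OF r0(3) e] by blast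
  define H where "H = hessian f x"
  define R where "R h = gradient f (x + h) - gradient f x - H *v h" for h
  show thesis
  proof (rule that[of "min r0 r1 / K"])
    show "min r0 r1 / K > 0" using r0 r1 K by simp
    fix s :: real assume s: "0 < s" "s < min r0 r1 / K"
    then have sK: "s * K < min r0 r1" using K by (simp add: pos_less_divide_eq)
    define F where "F t = f (x + s *\<^sub>R w + t *\<^sub>R (s *\<^sub>R u)) - f (x + t *\<^sub>R (s *\<^sub>R u))" for t
    have n1: "norm (s *\<^sub>R w + t *\<^sub>R (s *\<^sub>R u)) \<le> s * K" if "0 \<le> t" "t \<le> 1" for t
    proof -
      have "norm (s *\<^sub>R w + t *\<^sub>R (s *\<^sub>R u)) \<le> s * norm w + t * (s * norm u)"
        using that s by (intro norm_triangle_le) simp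
      also have "\<dots> \<le> s * norm w + s * norm u"
        using that s by (simp add: mult_left_le_one_le)
      also have "\<dots> \<le> s * K" using s unfolding K_def by (simp add: algebra_simps)
      finally show ?thesis .
    qed
    have n2: "norm (t *\<^sub>R (s *\<^sub>R u)) \<le> s * K" if "0 \<le> t" "t \<le> 1" for t
    proof -
      have "norm (t *\<^sub>R (s *\<^sub>R u)) \<le> s * norm u"
        using that s by (simp add: mult_left_le_one_le)
      also have "\<dots> \<le> s * K" using s unfolding K_def by (simp add: algebra_simps)
      finally show ?thesis .
    qed
    define D where "D t = (gradient f (x + s *\<^sub>R w + t *\<^sub>R (s *\<^sub>R u)) - gradient f (x + t *\<^sub>R (s *\<^sub>R u))) \<bullet> (s *\<^sub>R u)" for t
    have shift: "dist x (x + z) = norm z" for z :: "real^'a"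
      by (simp add: dist_norm)
    have "(F has_derivative (\<lambda>\<tau>. \<tau> * D t)) (at t within {0..1})" if t: "0 \<le> t" "t \<le> 1" for t
    proof -
      have 1: "(f has_derivative (\<lambda>h. gradient f (x + s *\<^sub>R w + t *\<^sub>R (s *\<^sub>R u)) \<bullet> h)) (at (x + s *\<^sub>R w + t *\<^sub>R (s *\<^sub>R u)))"
        using n1[OF t] sK shift[of "s *\<^sub>R w + t *\<^sub>R (s *\<^sub>R u)"] by (intro r0) (simp add: add.assoc)
      have 2: "(f has_derivative (\<lambda>h. gradient f (x + t *\<^sub>R (s *\<^sub>R u)) \<bullet> h)) (at (x + t *\<^sub>R (s *\<^sub>R u)))"
        using n2[OF t] sK shift[of "t *\<^sub>R (s *\<^sub>R u)"] by (intro r0) simp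
      have "((\<lambda>t. f (x + s *\<^sub>R w + t *\<^sub>R (s *\<^sub>R u))) has_derivative
          (\<lambda>\<tau>. gradient f (x + s *\<^sub>R w + t *\<^sub>R (s *\<^sub>R u)) \<bullet> (\<tau> *\<^sub>R (s *\<^sub>R u)))) (at t within {0..1})"
        by (rule has_derivative_compose[of "\<lambda>t. x + s *\<^sub>R w + t *\<^sub>R (s *\<^sub>R u)", OF _ 1])
           (auto intro!: derivative_eq_intros)
      moreover have "((\<lambda>t. f (x + t *\<^sub>R (s *\<^sub>R u))) has_derivative
          (\<lambda>\<tau>. gradient f (x + t *\<^sub>R (s *\<^sub>R u)) \<bullet> (\<tau> *\<^sub>R (s *\<^sub>R u)))) (at t within {0..1})"
        by (rule has_derivative_compose[of "\<lambda>t. x + t *\<^sub>R (s *\<^sub>R u)", OF _ 2])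
           (auto intro!: derivative_eq_intros)
      ultimately show ?thesis unfolding F_def
        by (rule has_derivative_eq_rhs[OF has_derivative_diff])
           (auto simp: D_def fun_eq_iff inner_diff_left algebra_simps)
    qed
    then obtain t where t: "t \<in> {0..1}" "F 1 - F 0 = D t"
      using mvt_very_simple[of 0 1 F "\<lambda>t s. s * D t"] by auto
    have "D t = s * ((H *v (s *\<^sub>R w) + R (s *\<^sub>R w + t *\<^sub>R (s *\<^sub>R u)) - R (t *\<^sub>R (s *\<^sub>R u))) \<bullet> u)"
      unfolding D_def R_def by (simp add: matrix_vector_right_distrib add.assoc)
    then have D: "D t - s\<^sup>2 * (u \<bullet> (H *v w)) = s * ((R (s *\<^sub>R w + t *\<^sub>R (s *\<^sub>R u)) - R (t *\<^sub>R (s *\<^sub>R u))) \<bullet> u)"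
      by (simp add: matrix_vector_mult_scaleR inner_add_left inner_diff_left inner_commute
          power2_eq_square algebra_simps)
    have R: "norm (R h) \<le> e * (s * K)" if "norm h \<le> s * K" for h
    proof -
      have "norm (R h) \<le> e * norm h" unfolding R_def H_def by (rule r1) (use that sK in auto)
      also have "\<dots> \<le> e * (s * K)" using that e by simp
      finally show ?thesis .
    qed
    have "\<bar>(R (s *\<^sub>R w + t *\<^sub>R (s *\<^sub>R u)) - R (t *\<^sub>R (s *\<^sub>R u))) \<bullet> u\<bar>
        \<le> norm (R (s *\<^sub>R w + t *\<^sub>R (s *\<^sub>R u)) - R (t *\<^sub>R (s *\<^sub>R u))) * norm u"
      by (rule Cauchy_Schwarz_ineq2)
    also have "\<dots> \<le> (e * (s * K) + e * (s * K)) * K"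
      using t by (intro mult_mono order_trans[OF norm_triangle_ineq4] add_mono R n1 n2)
        (use K e s in \<open>auto simp: K_def\<close>)
    also have "\<dots> = \<epsilon> * s" using K unfolding e_def by (simp add: field_simps)
    finally have "\<bar>D t - s\<^sup>2 * (u \<bullet> (H *v w))\<bar> \<le> s * (\<epsilon> * s)"
      unfolding D abs_mult using s by simp
    moreover have "F 1 - F 0 = f (x + s *\<^sub>R u + s *\<^sub>R w) - f (x + s *\<^sub>R u) - f (x + s *\<^sub>R w) + f x"
      by (simp add: F_def add.commute add.left_commute)
    ultimately show "\<bar>f (x + s *\<^sub>R u + s *\<^sub>R w) - f (x + s *\<^sub>R u) - f (x + s *\<^sub>R w) + f x
        - s\<^sup>2 * (u \<bullet> (hessian f x *v w))\<bar> \<le> \<epsilon> * s\<^sup>2"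
      using t(2) unfolding H_def by (simp add: power2_eq_square algebra_simps)
  qed
qed

text \<open>Schwarz's theorem: one and the same mixed difference approximates both values up to
  \<open>\<epsilon> * s\<^sup>2\<close>, so they differ by at most \<open>2 * \<epsilon>\<close>,
  less than the assumed gap \<open>3 * \<epsilon>\<close>. All facts on \<open>P1_plus\<close>
  require this symmetry.\<close>

lemma hessian_symmetric:
  assumes "C2_near f x"
  shows "u \<bullet> (hessian f x *v w) = w \<bullet> (hessian f x *v u)"
proof (rule ccontr)
  let ?a = "u \<bullet> (hessian f x *v w)" and ?b = "w \<bullet> (hessian f x *v u)"
  assume "?a \<noteq> ?b"
  define \<epsilon> where "\<epsilon> = \<bar>?a - ?b\<bar> / 3"
  have "\<epsilon> > 0" using \<open>?a \<noteq> ?b\<close> by (simp add: \<epsilon>_def)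
  obtain r1 where r1: "r1 > 0" "\<And>s. 0 < s \<Longrightarrow> s < r1 \<Longrightarrow>
      \<bar>f (x + s *\<^sub>R u + s *\<^sub>R w) - f (x + s *\<^sub>R u) - f (x + s *\<^sub>R w) + f x - s\<^sup>2 * ?a\<bar> \<le> \<epsilon> * s\<^sup>2"
    using mixed_difference_approx[OF assms \<open>\<epsilon> > 0\<close>] by blast
  obtain r2 where r2: "r2 > 0" "\<And>s. 0 < s \<Longrightarrow> s < r2 \<Longrightarrow>
      \<bar>f (x + s *\<^sub>R w + s *\<^sub>R u) - f (x + s *\<^sub>R w) - f (x + s *\<^sub>R u) + f x - s\<^sup>2 * ?b\<bar> \<le> \<epsilon> * s\<^sup>2"
    using mixed_difference_approx[OF assms \<open>\<epsilon> > 0\<close>] by blast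
  define s where "s = min r1 r2 / 2"
  have s: "0 < s" "s < r1" "s < r2" using r1 r2 by (auto simp: s_def)
  have "x + s *\<^sub>R w + s *\<^sub>R u = x + s *\<^sub>R u + s *\<^sub>R w" by simp
  then have "\<bar>s\<^sup>2 * ?a - s\<^sup>2 * ?b\<bar> \<le> 2 * (\<epsilon> * s\<^sup>2)"
    using r1(2)[OF s(1,2)] r2(2)[OF s(1,3)] by (smt (verit))
  then have "s\<^sup>2 * \<bar>?a - ?b\<bar> \<le> s\<^sup>2 * (2 * \<epsilon>)"
    by (simp add: abs_mult flip: right_diff_distrib) (simp add: mult.commute mult.left_commute)
  then have "\<bar>?a - ?b\<bar> \<le> 2 * \<epsilon>" using s by simp
  then show False using \<open>\<epsilon> > 0\<close> by (simp add: \<epsilon>_def)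
qed

text \<open>Supplies an admissible test function with a prescribed self-adjoint Hessian, for use
  against the viscosity definition.\<close>

lemma quadratic_function:
  fixes F :: "real^'n \<Rightarrow> real^'n" and a p :: "real^'n" and c :: real
  assumes F: "linear F" and sym: "\<And>u w. u \<bullet> F w = w \<bullet> F u"
  defines "q \<equiv> \<lambda>y. c + p \<bullet> (y - a) + ((y - a) \<bullet> F (y - a)) / 2"
  shows C2_near_quadratic: "C2_near q x"
    and hessian_quadratic: "hessian q x = matrix F"
proof -
  have bl: "bounded_linear F" using F by (rule linear_conv_bounded_linear[THEN iffD1])
  have dF: "((\<lambda>y. F (y - a)) has_derivative F) (at y)" for y
    by (rule has_derivative_eq_rhs[OF bounded_linear.has_derivative[OF bl]])
       (auto intro!: derivative_eq_intros)
  have "(q has_derivative (\<lambda>h. p \<bullet> h + ((y - a) \<bullet> F h + h \<bullet> F (y - a)) / 2)) (at y)" for y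
    unfolding q_def by (auto intro!: derivative_eq_intros dF)
  moreover have "p \<bullet> h + ((y - a) \<bullet> F h + h \<bullet> F (y - a)) / 2 = (p + F (y - a)) \<bullet> h" for y h
    using sym[of "y - a" h] by (simp add: inner_add_left inner_add_right inner_commute)
  ultimately have d: "(q has_derivative (\<lambda>h. (p + F (y - a)) \<bullet> h)) (at y)" for y
    by simp
  then have g: "gradient q = (\<lambda>y. p + F (y - a))"
    by (intro ext gradient_eqI)
  have dg: "(gradient q has_derivative F) (at y)" for y
    unfolding g by (auto intro!: derivative_eq_intros dF)
  have h: "hessian q y = matrix F" for y
    using frechet_derivative_at[OF dg[of y]] by (simp add: hessian_def)
  show "hessian q x = matrix F" by (rule h)
  show "C2_near q x" unfolding C2_near_def
    by (rule exI[of _ UNIV]) (use d dg h in \<open>auto simp: differentiable_on_def differentiable_def\<close>)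
qed

section \<open>Supersolutions as functions concave along chords\<close>

text \<open>\<open>second_diff_le v x k\<close> says that at \<open>x\<close> all second directional derivatives of \<open>v\<close> are at
  most \<open>k\<close>, uniformly in the direction.\<close>

definition second_diff_le :: "('a::real_normed_vector \<Rightarrow> real) \<Rightarrow> 'a \<Rightarrow> real \<Rightarrow> bool" where
  "second_diff_le v x k \<longleftrightarrow>
     (\<forall>\<epsilon>>0. \<forall>\<^sub>F h in nhds 0. v (x + h) + v (x - h) - 2 * v x \<le> (norm h)\<^sup>2 * (k + \<epsilon>))"

lemma eventually_nhds_symmetric_shift:
  fixes x :: "'a::real_normed_vector"
  assumes "\<forall>\<^sub>F y in nhds x. P y"
  shows "\<forall>\<^sub>F h in nhds 0. P (x + h) \<and> P (x - h)"
proof (rule eventually_conj)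
  have "((\<lambda>h. x + h) \<longlongrightarrow> x + 0) (nhds 0)" by (intro tendsto_intros filterlim_ident)
  then show "\<forall>\<^sub>F h in nhds 0. P (x + h)" using assms by (simp add: filterlim_iff)
  have "((\<lambda>h. x - h) \<longlongrightarrow> x - 0) (nhds 0)" by (intro tendsto_intros filterlim_ident)
  then show "\<forall>\<^sub>F h in nhds 0. P (x - h)" using assms by (simp add: filterlim_iff)
qed

lemma second_diff_le_mono:
  assumes "second_diff_le v x k" and "k \<le> l"
  shows "second_diff_le v x l"
  unfolding second_diff_le_def
proof (intro allI impI)
  fix \<epsilon> :: real assume "\<epsilon> > 0"
  then have "\<forall>\<^sub>F h in nhds 0. v (x + h) + v (x - h) - 2 * v x \<le> (norm h)\<^sup>2 * (k + \<epsilon>)"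
    using assms(1) unfolding second_diff_le_def by blast
  then show "\<forall>\<^sub>F h in nhds 0. v (x + h) + v (x - h) - 2 * v x \<le> (norm h)\<^sup>2 * (l + \<epsilon>)"
  proof eventually_elim
    case (elim h)
    then show ?case
      using mult_left_mono[of "k + \<epsilon>" "l + \<epsilon>" "(norm h)\<^sup>2"] assms(2) by simp
  qed
qed

text \<open>Both neighbours x + h and x - h can only be lower for \<open>v\<close>, while the centre
  is the same. Every cut-off and pasting of supersolutions rests on this.\<close>

lemma second_diff_le_touch:
  assumes "second_diff_le w x k" and "\<forall>\<^sub>F y in nhds x. v y \<le> w y" and "v x = w x"
  shows "second_diff_le v x k"
  unfolding second_diff_le_def
proof (intro allI impI)
  fix \<epsilon> :: real assume "\<epsilon> > 0"
  then have "\<forall>\<^sub>F h in nhds 0. w (x + h) + w (x - h) - 2 * w x \<le> (norm h)\<^sup>2 * (k + \<epsilon>)"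
    using assms(1) unfolding second_diff_le_def by blast
  then show "\<forall>\<^sub>F h in nhds 0. v (x + h) + v (x - h) - 2 * v x \<le> (norm h)\<^sup>2 * (k + \<epsilon>)"
    using eventually_nhds_symmetric_shift[OF assms(2)]
    by eventually_elim (use assms(3) in linarith)
qed

lemma second_diff_le_add:
  assumes "second_diff_le v x k" and "second_diff_le w x l"
  shows "second_diff_le (\<lambda>y. v y + w y) x (k + l)"
  unfolding second_diff_le_def
proof (intro allI impI)
  fix \<epsilon> :: real assume "\<epsilon> > 0"
  then have "\<epsilon> / 2 > 0" by simp
  then have "\<forall>\<^sub>F h in nhds 0. v (x + h) + v (x - h) - 2 * v x \<le> (norm h)\<^sup>2 * (k + \<epsilon> / 2)"
    "\<forall>\<^sub>F h in nhds 0. w (x + h) + w (x - h) - 2 * w x \<le> (norm h)\<^sup>2 * (l + \<epsilon> / 2)"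
    using assms unfolding second_diff_le_def by blast+
  then show "\<forall>\<^sub>F h in nhds 0. v (x + h) + w (x + h) + (v (x - h) + w (x - h)) - 2 * (v x + w x)
      \<le> (norm h)\<^sup>2 * (k + l + \<epsilon>)"
    by eventually_elim (simp add: algebra_simps)
qed

lemma second_diff_le_cmult:
  assumes "second_diff_le v x k" and "c > 0"
  shows "second_diff_le (\<lambda>y. c * v y) x (c * k)"
  unfolding second_diff_le_def
proof (intro allI impI)
  fix \<epsilon> :: real assume "\<epsilon> > 0"
  then have "\<epsilon> / c > 0" using \<open>c > 0\<close> by simp
  then have "\<forall>\<^sub>F h in nhds 0. v (x + h) + v (x - h) - 2 * v x \<le> (norm h)\<^sup>2 * (k + \<epsilon> / c)"
    using assms unfolding second_diff_le_def by blast
  then show "\<forall>\<^sub>F h in nhds 0. c * v (x + h) + c * v (x - h) - 2 * (c * v x)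
      \<le> (norm h)\<^sup>2 * (c * k + \<epsilon>)"
  proof eventually_elim
    case (elim h)
    then have "c * (v (x + h) + v (x - h) - 2 * v x) \<le> c * ((norm h)\<^sup>2 * (k + \<epsilon> / c))"
      using assms(2) by simp
    then show ?case using assms(2) by (simp add: algebra_simps)
  qed
qed

lemma second_diff_le_quadratic:
  fixes a p :: "'a::real_inner"
  shows "second_diff_le (\<lambda>y. c + p \<bullet> (y - a) + k / 2 * (norm (y - a))\<^sup>2) x k"
  unfolding second_diff_le_def
proof (intro allI impI always_eventually)
  fix \<epsilon> :: real and h :: 'a assume "\<epsilon> > 0"
  have "(c + p \<bullet> (x + h - a) + k / 2 * (norm (x + h - a))\<^sup>2) + (c + p \<bullet> (x - h - a) + k / 2 * (norm (x - h - a))\<^sup>2)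
      - 2 * (c + p \<bullet> (x - a) + k / 2 * (norm (x - a))\<^sup>2) = k * (norm h)\<^sup>2"
    unfolding power2_norm_eq_inner
    by (simp add: inner_add_left inner_add_right inner_diff_left inner_diff_right inner_commute algebra_simps)
  also have "\<dots> \<le> (norm h)\<^sup>2 * (k + \<epsilon>)" using \<open>\<epsilon> > 0\<close> by (simp add: algebra_simps)
  finally show "(c + p \<bullet> (x + h - a) + k / 2 * (norm (x + h - a))\<^sup>2) + (c + p \<bullet> (x - h - a) + k / 2 * (norm (x - h - a))\<^sup>2)
      - 2 * (c + p \<bullet> (x - a) + k / 2 * (norm (x - a))\<^sup>2) \<le> (norm h)\<^sup>2 * (k + \<epsilon>)" .
qed

text \<open>Nonnegative continuous supersolutions of \<open>\<lambda>\<^sub>N(D\<^sup>2v) + \<mu> v = - g\<close>.\<close>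

definition supersols :: "'a::real_normed_vector set \<Rightarrow> real \<Rightarrow> real \<Rightarrow> ('a \<Rightarrow> real) set" where
  "supersols \<Omega> \<mu> g = {v. continuous_on \<Omega> v \<and> (\<forall>x\<in>\<Omega>. 0 \<le> v x) \<and>
     (\<forall>x\<in>\<Omega>. second_diff_le v x (- (\<mu> * v x + g)))}"

lemma supersolsI:
  assumes "continuous_on \<Omega> v" and "\<And>x. x \<in> \<Omega> \<Longrightarrow> 0 \<le> v x"
    and "\<And>x. x \<in> \<Omega> \<Longrightarrow> second_diff_le v x (- (\<mu> * v x + g))"
  shows "v \<in> supersols \<Omega> \<mu> g"
  using assms by (simp add: supersols_def)

lemma supersolsD:
  assumes "v \<in> supersols \<Omega> \<mu> g"
  shows "continuous_on \<Omega> v" and "x \<in> \<Omega> \<Longrightarrow> 0 \<le> v x"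
    and "x \<in> \<Omega> \<Longrightarrow> second_diff_le v x (- (\<mu> * v x + g))"
  using assms by (simp_all add: supersols_def)

lemma supersols_change:
  assumes "v \<in> supersols \<Omega> \<mu> g" and "\<And>x. x \<in> \<Omega> \<Longrightarrow> \<mu>' * v x + g' \<le> \<mu> * v x + g"
  shows "v \<in> supersols \<Omega> \<mu>' g'"
proof (rule supersolsI)
  show "second_diff_le v x (- (\<mu>' * v x + g'))" if "x \<in> \<Omega>" for x
    using supersolsD(3)[OF assms(1) that] assms(2)[OF that] second_diff_le_mono by fastforce
qed (use supersolsD[OF assms(1)] in auto)

lemma supersols_cmult:
  assumes "v \<in> supersols \<Omega> \<mu> g" and "c > 0"
  shows "(\<lambda>x. c * v x) \<in> supersols \<Omega> \<mu> (c * g)"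
proof (rule supersolsI)
  show "second_diff_le (\<lambda>x. c * v x) x (- (\<mu> * (c * v x) + c * g))" if "x \<in> \<Omega>" for x
    using second_diff_le_cmult[OF supersolsD(3)[OF assms(1) that] assms(2)]
    by (simp add: algebra_simps)
  show "0 \<le> c * v x" if "x \<in> \<Omega>" for x
    using supersolsD(2)[OF assms(1) that] assms(2) by simp
  show "continuous_on \<Omega> (\<lambda>x. c * v x)"
    by (intro continuous_intros supersolsD(1)[OF assms(1)])
qed

text \<open>The chord inequality says that \<open>v + m/2 |x|\<^sup>2\<close> is concave along every segment on which
  \<open>m \<le> \<mu> v + g\<close>; unlike the infinitesimal condition it passes to infima and pointwise limits.\<close>

definition chord_ineq :: "'a::real_normed_vector set \<Rightarrow> real \<Rightarrow> real \<Rightarrow> ('a \<Rightarrow> real) \<Rightarrow> bool" where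
  "chord_ineq \<Omega> \<mu> g v \<longleftrightarrow>
     (\<forall>a b m (t::real). closed_segment a b \<subseteq> \<Omega> \<longrightarrow> (\<forall>y\<in>closed_segment a b. m \<le> \<mu> * v y + g) \<longrightarrow>
        0 \<le> t \<longrightarrow> t \<le> 1 \<longrightarrow>
        (1 - t) * v a + t * v b + m / 2 * (t * (1 - t)) * (norm (b - a))\<^sup>2
          \<le> v ((1 - t) *\<^sub>R a + t *\<^sub>R b))"

lemma chord_ineqD:
  assumes "chord_ineq \<Omega> \<mu> g v" "closed_segment a b \<subseteq> \<Omega>"
    "\<And>y. y \<in> closed_segment a b \<Longrightarrow> m \<le> \<mu> * v y + g" "0 \<le> t" "t \<le> 1"
  shows "(1 - t) * v a + t * v b + m / 2 * (t * (1 - t)) * (norm (b - a))\<^sup>2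
          \<le> v ((1 - t) *\<^sub>R a + t *\<^sub>R b)"
  using assms unfolding chord_ineq_def by blast

text \<open>The inequality is closed in \<open>m\<close>, so it may be proved for all smaller
  values. The strict gap is the room needed for contradiction and limit arguments.\<close>

lemma chord_ineq_weakenI:
  assumes "\<And>a b m t::real. closed_segment a b \<subseteq> \<Omega> \<Longrightarrow> (\<And>y. y \<in> closed_segment a b \<Longrightarrow> m < \<mu> * v y + g) \<Longrightarrow>
        0 \<le> t \<Longrightarrow> t \<le> 1 \<Longrightarrow>
        (1 - t) * v a + t * v b + m / 2 * (t * (1 - t)) * (norm (b - a))\<^sup>2
          \<le> v ((1 - t) *\<^sub>R a + t *\<^sub>R b)"
  shows "chord_ineq \<Omega> \<mu> g v"
  unfolding chord_ineq_def
proof (intro allI impI)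
  fix a b m and t :: real
  assume seg: "closed_segment a b \<subseteq> \<Omega>" and m: "\<forall>y\<in>closed_segment a b. m \<le> \<mu> * v y + g"
    and t: "0 \<le> t" "t \<le> 1"
  let ?F = "\<lambda>m. (1 - t) * v a + t * v b + m / 2 * (t * (1 - t)) * (norm (b - a))\<^sup>2"
  have "(?F \<longlongrightarrow> ?F m) (at_left m)" by (intro tendsto_intros) auto
  moreover have "\<forall>\<^sub>F m' in at_left m. ?F m' \<le> v ((1 - t) *\<^sub>R a + t *\<^sub>R b)"
    unfolding eventually_at_left_field
  proof (intro exI[of _ "m - 1"] conjI allI impI)
    fix y assume "m - 1 < y" "y < m"
    show "?F y \<le> v ((1 - t) *\<^sub>R a + t *\<^sub>R b)"
      by (rule assms[OF seg _ t]) (use m \<open>y < m\<close> in force)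
  qed simp
  ultimately show "?F m \<le> v ((1 - t) *\<^sub>R a + t *\<^sub>R b)"
    by (intro tendsto_upperbound) auto
qed

text \<open>One-dimensional minimum principle: the defect \<open>f\<close> vanishes at both ends. At
  a negative interior minimum its second differences would be nonnegative, but the strict bound on
  \<open>m\<close> makes them negative.\<close>

lemma second_diff_imp_chord_ineq:
  assumes cont: "continuous_on \<Omega> v"
    and sd: "\<And>x. x \<in> \<Omega> \<Longrightarrow> second_diff_le v x (- (\<mu> * v x + g))"
  shows "chord_ineq \<Omega> \<mu> g v"
proof (rule chord_ineq_weakenI)
  fix a b m and t :: real
  assume seg: "closed_segment a b \<subseteq> \<Omega>" and m: "\<And>y. y \<in> closed_segment a b \<Longrightarrow> m < \<mu> * v y + g"
    and t: "0 \<le> t" "t \<le> 1"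
  define e where "e = b - a"
  define f where "f s = v (a + s *\<^sub>R e) - (1 - s) * v a - s * v b - m / 2 * (s * (1 - s)) * (norm e)\<^sup>2" for s
  have in_seg: "a + s *\<^sub>R e \<in> closed_segment a b" if "0 \<le> s" "s \<le> 1" for s
    unfolding in_segment e_def using that by (intro exI[of _ s]) (simp add: algebra_simps)
  have "continuous_on {0..1} (\<lambda>s. v (a + s *\<^sub>R e))"
    by (rule continuous_on_compose2[OF cont]) (use in_seg seg in \<open>auto intro!: continuous_intros\<close>)
  then have "continuous_on {0..1} f"
    unfolding f_def by (intro continuous_intros)
  then obtain s where s: "s \<in> {0..1}" and min: "\<And>y. y \<in> {0..1} \<Longrightarrow> f s \<le> f y"
    using continuous_attains_inf[of "{0..1::real}" f] by auto
  have "f s \<ge> 0"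
  proof (rule ccontr)
    assume neg: "\<not> f s \<ge> 0"
    have "f 0 = 0" "f 1 = 0" by (auto simp: f_def e_def)
    then have s01: "0 < s" "s < 1" using s neg by (auto simp: less_le)
    have "e \<noteq> 0"
    proof
      assume "e = 0"
      then have "f s = 0" unfolding f_def by (simp add: e_def algebra_simps)
      then show False using neg by simp
    qed
    define x where "x = a + s *\<^sub>R e"
    have x: "x \<in> closed_segment a b" unfolding x_def using in_seg s by auto
    define \<epsilon> where "\<epsilon> = \<mu> * v x + g - m"
    have "\<epsilon> > 0" using m[OF x] by (simp add: \<epsilon>_def)
    then have "\<forall>\<^sub>F h in nhds 0. v (x + h) + v (x - h) - 2 * v x \<le> (norm h)\<^sup>2 * (- (\<mu> * v x + g) + \<epsilon> / 2)"
      using sd[of x] x seg unfolding second_diff_le_def by (meson half_gt_zero subsetD)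
    then obtain r where r: "r > 0" "\<And>h. norm h < r \<Longrightarrow>
        v (x + h) + v (x - h) - 2 * v x \<le> (norm h)\<^sup>2 * (- (\<mu> * v x + g) + \<epsilon> / 2)"
      unfolding eventually_nhds_metric by (auto simp: dist_norm)
    \<comment> \<open>Keeps both \<open>s + \<tau>\<close> and \<open>s - \<tau>\<close> in [0,1]
      and the displacement inside the radius r.\<close>
    define \<tau> where "\<tau> = min (min s (1 - s)) (r / (2 * norm e))"
    have \<tau>: "\<tau> > 0" "\<tau> \<le> s" "\<tau> \<le> 1 - s" "\<tau> \<le> r / (2 * norm e)"
      using s01 r \<open>e \<noteq> 0\<close> by (auto simp: \<tau>_def)
    have "\<tau> * norm e \<le> r / 2" using \<tau>(4) \<open>e \<noteq> 0\<close> by (simp add: field_simps)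
    then have "norm (\<tau> *\<^sub>R e) < r" using \<tau> r by simp
    then have "v (x + \<tau> *\<^sub>R e) + v (x - \<tau> *\<^sub>R e) - 2 * v x \<le> (norm (\<tau> *\<^sub>R e))\<^sup>2 * (- (\<mu> * v x + g) + \<epsilon> / 2)"
      by (rule r(2))
    also have "(norm (\<tau> *\<^sub>R e))\<^sup>2 = \<tau>\<^sup>2 * (norm e)\<^sup>2"
      by (simp add: power_mult_distrib)
    also have "- (\<mu> * v x + g) + \<epsilon> / 2 = - m - \<epsilon> / 2" by (simp add: \<epsilon>_def field_simps)
    finally have 1: "v (x + \<tau> *\<^sub>R e) + v (x - \<tau> *\<^sub>R e) - 2 * v x \<le> \<tau>\<^sup>2 * (norm e)\<^sup>2 * (- m - \<epsilon> / 2)" .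
    have xp: "x + \<tau> *\<^sub>R e = a + (s + \<tau>) *\<^sub>R e" "x - \<tau> *\<^sub>R e = a + (s - \<tau>) *\<^sub>R e"
      by (simp_all add: x_def algebra_simps)
    have "f (s + \<tau>) + f (s - \<tau>) - 2 * f s
        = v (x + \<tau> *\<^sub>R e) + v (x - \<tau> *\<^sub>R e) - 2 * v x + m * \<tau>\<^sup>2 * (norm e)\<^sup>2"
      unfolding f_def xp x_def[symmetric] by (simp add: field_simps power2_eq_square)
    also have "\<dots> \<le> \<tau>\<^sup>2 * (norm e)\<^sup>2 * (- \<epsilon> / 2)" using 1 by (simp add: algebra_simps)
    also have "\<dots> < 0" using \<tau> \<open>e \<noteq> 0\<close> \<open>\<epsilon> > 0\<close> by (simp add: mult_pos_neg)
    finally show False using min[of "s + \<tau>"] min[of "s - \<tau>"] \<tau> s01 by simp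
  qed
  then have "f t \<ge> 0" using min[of t] t by simp
  moreover have "a + t *\<^sub>R e = (1 - t) *\<^sub>R a + t *\<^sub>R b" by (simp add: e_def algebra_simps)
  ultimately show "(1 - t) * v a + t * v b + m / 2 * (t * (1 - t)) * (norm (b - a))\<^sup>2
          \<le> v ((1 - t) *\<^sub>R a + t *\<^sub>R b)"
    by (simp add: f_def flip: e_def)
qed

lemma chord_ineq_midpoint:
  fixes x h :: "'a::real_normed_vector"
  assumes "chord_ineq \<Omega> \<mu> g v" "closed_segment (x - h) (x + h) \<subseteq> \<Omega>"
    "\<And>y. y \<in> closed_segment (x - h) (x + h) \<Longrightarrow> m \<le> \<mu> * v y + g"
  shows "v (x + h) + v (x - h) - 2 * v x \<le> - m * (norm h)\<^sup>2"
proof -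
  have "(1 - 1 / 2) *\<^sub>R (x - h) + (1 / 2) *\<^sub>R (x + h) = x"
    by (simp add: scaleR_right_diff_distrib scaleR_right_distrib flip: scaleR_left_distrib)
  moreover have "x + h - (x - h) = 2 *\<^sub>R h" by (simp add: scaleR_2)
  ultimately show ?thesis
    using chord_ineqD[OF assms, of "1 / 2"] by (simp add: power_mult_distrib field_simps)
qed

text \<open>On short chords around x continuity makes \<open>\<mu> * v x + g - \<epsilon>\<close> an
  admissible \<open>m\<close>; the midpoint case of the chord inequality is then the second
  difference bound.\<close>

lemma chord_ineq_imp_second_diff:
  assumes "open \<Omega>" and cont: "continuous_on \<Omega> v" and ch: "chord_ineq \<Omega> \<mu> g v" and x: "x \<in> \<Omega>"
  shows "second_diff_le v x (- (\<mu> * v x + g))"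
  unfolding second_diff_le_def
proof (intro allI impI)
  fix \<epsilon> :: real assume "\<epsilon> > 0"
  have "isCont v x" using assms continuous_on_eq_continuous_at by blast
  then have "((\<lambda>y. \<mu> * v y + g) \<longlongrightarrow> \<mu> * v x + g) (nhds x)"
    by (intro tendsto_intros) (simp add: continuous_at tendsto_at_iff_tendsto_nhds)
  then have "\<forall>\<^sub>F y in nhds x. \<mu> * v x + g - \<epsilon> < \<mu> * v y + g"
    by (rule order_tendstoD(1)) (use \<open>\<epsilon> > 0\<close> in simp)
  moreover have "\<forall>\<^sub>F y in nhds x. y \<in> \<Omega>" using assms eventually_nhds_in_open by blast
  ultimately have "\<forall>\<^sub>F y in nhds x. \<mu> * v x + g - \<epsilon> < \<mu> * v y + g \<and> y \<in> \<Omega>"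
    by eventually_elim simp
  then obtain r where r: "r > 0" "\<And>y. dist y x < r \<Longrightarrow> \<mu> * v x + g - \<epsilon> < \<mu> * v y + g \<and> y \<in> \<Omega>"
    unfolding eventually_nhds_metric by blast
  have "v (x + h) + v (x - h) - 2 * v x \<le> (norm h)\<^sup>2 * (- (\<mu> * v x + g) + \<epsilon>)" if "norm h < r" for h
  proof -
    have "closed_segment (x - h) (x + h) \<subseteq> ball x r"
      by (rule closed_segment_subset) (use that in \<open>auto simp: dist_norm\<close>)
    then have "v (x + h) + v (x - h) - 2 * v x \<le> - (\<mu> * v x + g - \<epsilon>) * (norm h)\<^sup>2"
      using r by (intro chord_ineq_midpoint[OF ch]) (force simp: dist_commute less_imp_le)+
    then show ?thesis by (simp add: algebra_simps)
  qed
  then show "\<forall>\<^sub>F h in nhds 0. v (x + h) + v (x - h) - 2 * v x \<le> (norm h)\<^sup>2 * (- (\<mu> * v x + g) + \<epsilon>)"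
    unfolding eventually_nhds_metric using r(1) by (auto simp: dist_norm)
qed

lemma supersols_chord_ineq:
  assumes "v \<in> supersols \<Omega> \<mu> g"
  shows "chord_ineq \<Omega> \<mu> g v"
  using supersolsD[OF assms] by (intro second_diff_imp_chord_ineq)

text \<open>With all data nonnegative, \<open>m = 0\<close> is admissible on every chord.\<close>

lemma chord_ineq_imp_concave:
  assumes "chord_ineq \<Omega> \<mu> g v" and "convex \<Omega>" and "\<And>x. x \<in> \<Omega> \<Longrightarrow> 0 \<le> v x" and "0 \<le> \<mu>" "0 \<le> g"
  shows "concave_on \<Omega> v"
  unfolding concave_on_iff
proof (intro conjI ballI allI impI)
  fix x y and s t :: real assume *: "x \<in> \<Omega>" "y \<in> \<Omega>" "0 \<le> s" "0 \<le> t" "s + t = 1"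
  have seg: "closed_segment x y \<subseteq> \<Omega>" using * assms(2) by (simp add: closed_segment_subset)
  then have "0 \<le> \<mu> * v z + g" if "z \<in> closed_segment x y" for z
    using assms(3,4,5) that by (meson add_nonneg_nonneg mult_nonneg_nonneg subsetD)
  then have "(1 - t) * v x + t * v y + 0 / 2 * (t * (1 - t)) * (norm (y - x))\<^sup>2
      \<le> v ((1 - t) *\<^sub>R x + t *\<^sub>R y)"
    using * by (intro chord_ineqD[OF assms(1) seg]) auto
  moreover have "s = 1 - t" using * by simp
  ultimately show "v (s *\<^sub>R x + t *\<^sub>R y) \<ge> s * v x + t * v y" by simp
qed (rule assms(2))

lemma concave_on_imp_continuous:
  fixes \<Omega> :: "'a::euclidean_space set"
  assumes "concave_on \<Omega> v" and "open \<Omega>"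
  shows "continuous_on \<Omega> v"
  using convex_on_continuous[of \<Omega> "\<lambda>x. - v x"] assms continuous_on_minus[of \<Omega> "\<lambda>x. - v x"]
  by (simp add: concave_on_def)

text \<open>Continuity comes for free, because concave functions on open sets of a Euclidean space
  are continuous. Infima and limits therefore need only the chord inequality.\<close>

lemma chord_ineq_imp_supersols:
  fixes \<Omega> :: "'a::euclidean_space set"
  assumes "chord_ineq \<Omega> \<mu> g v" "open \<Omega>" "convex \<Omega>" "\<And>x. x \<in> \<Omega> \<Longrightarrow> 0 \<le> v x" "0 \<le> \<mu>" "0 \<le> g"
  shows "v \<in> supersols \<Omega> \<mu> g"
proof -
  have "continuous_on \<Omega> v"
    using chord_ineq_imp_concave[OF assms(1,3-6)] assms(2) by (rule concave_on_imp_continuous)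
  then show ?thesis
    using assms by (intro supersolsI chord_ineq_imp_second_diff)
qed

section \<open>The least nonnegative supersolution\<close>

definition least_supersol :: "'a::real_normed_vector set \<Rightarrow> real \<Rightarrow> real \<Rightarrow> 'a \<Rightarrow> real" where
  "least_supersol \<Omega> \<mu> g x = (INF v\<in>supersols \<Omega> \<mu> g. v x)"

lemma least_supersol_le:
  assumes "v \<in> supersols \<Omega> \<mu> g" "x \<in> \<Omega>"
  shows "least_supersol \<Omega> \<mu> g x \<le> v x"
  unfolding least_supersol_def
  by (rule cINF_lower[OF bdd_belowI2[of _ 0] assms(1)]) (use supersolsD(2) assms(2) in blast)

text \<open>Since \<open>\<mu>\<close> is nonnegative, an \<open>m\<close> admissible for the
  infimum is admissible for every member above it. Each member satisfies its chord inequality with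
  this \<open>m\<close>, and the infimum inherits it.\<close>

lemma least_supersol_mem:
  fixes \<Omega> :: "'a::euclidean_space set"
  assumes ne: "supersols \<Omega> \<mu> g \<noteq> {}" and "open \<Omega>" "convex \<Omega>" "0 \<le> \<mu>" "0 \<le> g"
  shows "least_supersol \<Omega> \<mu> g \<in> supersols \<Omega> \<mu> g"
proof (rule chord_ineq_imp_supersols)
  let ?u = "least_supersol \<Omega> \<mu> g"
  show "0 \<le> ?u x" if "x \<in> \<Omega>" for x
    unfolding least_supersol_def by (rule cINF_greatest[OF ne]) (rule supersolsD(2)[OF _ that])
  show "chord_ineq \<Omega> \<mu> g ?u"
    unfolding chord_ineq_def
  proof (intro allI impI)
    fix a b m and t :: real
    assume seg: "closed_segment a b \<subseteq> \<Omega>" and m: "\<forall>y\<in>closed_segment a b. m \<le> \<mu> * ?u y + g"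
      and t: "0 \<le> t" "t \<le> 1"
    show "(1 - t) * ?u a + t * ?u b + m / 2 * (t * (1 - t)) * (norm (b - a))\<^sup>2
          \<le> ?u ((1 - t) *\<^sub>R a + t *\<^sub>R b)"
      unfolding least_supersol_def[of _ _ _ "(1 - t) *\<^sub>R a + t *\<^sub>R b"]
    proof (rule cINF_greatest[OF ne])
      fix v assume v: "v \<in> supersols \<Omega> \<mu> g"
      have le: "?u y \<le> v y" if "y \<in> closed_segment a b" for y
        using least_supersol_le[OF v] seg that by blast
      have "m \<le> \<mu> * v y + g" if "y \<in> closed_segment a b" for y
        using m le[OF that] that \<open>0 \<le> \<mu>\<close> by (smt (verit) mult_left_mono)
      then have "(1 - t) * v a + t * v b + m / 2 * (t * (1 - t)) * (norm (b - a))\<^sup>2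
          \<le> v ((1 - t) *\<^sub>R a + t *\<^sub>R b)"
        using chord_ineqD[OF supersols_chord_ineq[OF v] seg _ t] by blast
      moreover have "(1 - t) * ?u a \<le> (1 - t) * v a" "t * ?u b \<le> t * v b"
        using le[of a] le[of b] t by (auto intro!: mult_left_mono)
      ultimately show "(1 - t) * ?u a + t * ?u b + m / 2 * (t * (1 - t)) * (norm (b - a))\<^sup>2
          \<le> v ((1 - t) *\<^sub>R a + t *\<^sub>R b)" by linarith
    qed
  qed
qed fact+

section \<open>Harnack-type estimates for nonnegative concave functions\<close>

lemma concave_on_combination:
  assumes "concave_on S f" "x \<in> S" "y \<in> S" "0 \<le> s" "0 \<le> t" "s + t = 1"
  shows "s * f x + t * f y \<le> f (s *\<^sub>R x + t *\<^sub>R y)"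
  using assms unfolding concave_on_iff by blast

text \<open>z is a convex combination of x and a point beyond z on the line from x, and the value at
  that point is dropped as nonnegative. This Harnack inequality yields boundedness, positivity, the
  Lipschitz bound and the bound on the parameter.\<close>

lemma concave_reflect:
  fixes x z :: "'a::real_vector"
  assumes "concave_on \<Omega> v" "\<And>y. y \<in> \<Omega> \<Longrightarrow> 0 \<le> v y" "x \<in> \<Omega>" "z - k *\<^sub>R (x - z) \<in> \<Omega>" "0 < k"
  shows "k * v x \<le> (1 + k) * v z"
proof -
  let ?y = "z - k *\<^sub>R (x - z)"
  have "(k / (1 + k)) *\<^sub>R x + (1 / (1 + k)) *\<^sub>R ?y = (1 / (1 + k)) *\<^sub>R (k *\<^sub>R x + ?y)"
    by (simp add: scaleR_right_distrib)
  also have "k *\<^sub>R x + ?y = (1 + k) *\<^sub>R z" by (simp add: algebra_simps)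
  finally have "(k / (1 + k)) *\<^sub>R x + (1 / (1 + k)) *\<^sub>R ?y = z" using assms(5) by simp
  moreover have "k / (1 + k) * v x + 1 / (1 + k) * v ?y \<le> v ((k / (1 + k)) *\<^sub>R x + (1 / (1 + k)) *\<^sub>R ?y)"
    by (rule concave_on_combination[OF assms(1)])
      (use assms(3-5) in \<open>auto simp: add_divide_distrib[symmetric] add.commute\<close>)
  moreover have "0 \<le> 1 / (1 + k) * v ?y" using assms by simp
  ultimately have "k / (1 + k) * v x \<le> v z" by simp
  then show ?thesis using assms(5) by (simp add: field_simps)
qed

lemma concave_bdd_above:
  fixes \<Omega> :: "'a::real_normed_vector set"
  assumes "concave_on \<Omega> v" "\<And>y. y \<in> \<Omega> \<Longrightarrow> 0 \<le> v y" "open \<Omega>" "bounded \<Omega>"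
  shows "bdd_above (v ` \<Omega>)"
proof (cases "\<Omega> = {}")
  case False
  then obtain z where z: "z \<in> \<Omega>" by blast
  obtain R where R: "R > 0" "cball z R \<subseteq> \<Omega>" using z \<open>open \<Omega>\<close> open_contains_cball by blast
  obtain D where D: "\<And>x. x \<in> \<Omega> \<Longrightarrow> dist z x \<le> D" using \<open>bounded \<Omega>\<close> bounded_any_center by metis
  \<comment> \<open>The factor \<open>k\<close> is so small that the reflected point stays within
    \<open>R\<close> of z for every x in the domain; the maximum with 1 avoids division by
    0.\<close>
  define D' where "D' = max D 1"
  define k where "k = R / D'"
  have k: "k > 0" using R by (simp add: k_def D'_def)
  show ?thesis
  proof (rule bdd_aboveI2)
    fix x assume x: "x \<in> \<Omega>"
    have "norm (x - z) \<le> D'" using D[OF x] by (simp add: dist_norm norm_minus_commute D'_def)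
    then have "k * norm (x - z) \<le> R" using R unfolding k_def D'_def
      by (simp add: field_simps mult_left_mono)
    then have "z - k *\<^sub>R (x - z) \<in> \<Omega>" using R(2) k by (auto simp: subset_iff dist_norm)
    then have "k * v x \<le> (1 + k) * v z" using concave_reflect[OF assms(1,2) x _ k] by blast
    then show "v x \<le> (1 + k) * v z / k" using k by (simp add: field_simps)
  qed
qed simp

lemma concave_pos:
  fixes \<Omega> :: "'a::real_normed_vector set"
  assumes "concave_on \<Omega> v" "\<And>y. y \<in> \<Omega> \<Longrightarrow> 0 \<le> v y" "open \<Omega>" "x \<in> \<Omega>" "y \<in> \<Omega>" "0 < v y"
  shows "0 < v x"
proof -
  obtain R where R: "R > 0" "cball x R \<subseteq> \<Omega>" using assms open_contains_cball by blast
  define k where "k = R / (norm (y - x) + 1)"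
  have k: "k > 0" using R by (simp add: k_def add_nonneg_pos)
  have "k * norm (y - x) \<le> R"
    using R by (simp add: k_def divide_le_eq add_nonneg_pos algebra_simps not_less)
  then have "x - k *\<^sub>R (y - x) \<in> \<Omega>" using R(2) k by (auto simp: subset_iff dist_norm)
  then have "k * v y \<le> (1 + k) * v x" using concave_reflect[OF assms(1,2,5) _ k] by blast
  moreover have "0 < k * v y" using k assms by simp
  ultimately have "0 < (1 + k) * v x" by linarith
  then show ?thesis using k by (simp add: zero_less_mult_iff)
qed

text \<open>The segment from z to y is prolonged to distance \<open>R\<close> in both directions;
  each prolongation bounds one sign of the difference. The constant depends only on \<open>R\<close>
  and the bound 1, which gives equicontinuity of a whole sequence.\<close>

lemma concave_local_Lipschitz:
  fixes z :: "'a::real_normed_vector"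
  assumes "concave_on \<Omega> v" "\<And>y. y \<in> \<Omega> \<Longrightarrow> 0 \<le> v y" "\<And>y. y \<in> \<Omega> \<Longrightarrow> v y \<le> 1"
    and R: "0 < R" "cball z R \<subseteq> \<Omega>" and y: "dist z y < R"
  shows "\<bar>v z - v y\<bar> \<le> dist z y / R"
proof (cases "y = z")
  case False
  define s where "s = norm (y - z)"
  have s: "0 < s" "s < R" using False y by (auto simp: s_def dist_norm norm_minus_commute)
  have z: "z \<in> \<Omega>" "y \<in> \<Omega>" using R y by auto
  define k where "k = R / s"
  have k: "k > 1" using s by (simp add: k_def)
  have "norm (k *\<^sub>R (y - z)) = R" using s R(1) by (simp add: k_def s_def)
  then have pm: "z - k *\<^sub>R (y - z) \<in> \<Omega>" "z + k *\<^sub>R (y - z) \<in> \<Omega>" 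
    using R(2) by (auto simp: subset_iff dist_norm simp del: norm_scaleR)
  have "k * v y \<le> (1 + k) * v z" using concave_reflect[OF assms(1,2) z(2) pm(1)] k by simp
  then have "k * (v y - v z) \<le> 1" using assms(3)[OF z(1)] by (simp add: algebra_simps)
  then have 1: "v y - v z \<le> 1 / k" using k by (simp add: field_simps)
  have "(1 - 1 / k) *\<^sub>R z + (1 / k) *\<^sub>R (z + k *\<^sub>R (y - z)) = y"
    using k by (simp add: scaleR_right_distrib scaleR_left_diff_distrib)
  then have "(1 - 1 / k) * v z + 1 / k * v (z + k *\<^sub>R (y - z)) \<le> v y"
    using concave_on_combination[OF assms(1) z(1) pm(2), of "1 - 1 / k" "1 / k"] k by simp
  moreover have "0 \<le> 1 / k * v (z + k *\<^sub>R (y - z))" using assms(2) pm k by simp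
  ultimately have "v z - v y \<le> 1 / k * v z" by (simp add: algebra_simps)
  also have "\<dots> \<le> 1 / k" using assms(2,3)[OF z(1)] k by (simp add: divide_right_mono)
  finally show ?thesis using 1 by (simp add: k_def s_def dist_norm norm_minus_commute abs_le_iff)
qed simp

section \<open>Comparison with viscosity supersolutions\<close>

text \<open>Along an eigenvector of the largest eigenvalue the gradient terms cancel in the second
  difference. Two Taylor errors and the slack in \<open>second_diff_le\<close> account for
  \<open>\<epsilon> / 3\<close> each.\<close>

lemma second_diff_le_imp_P1_plus_le:
  assumes C2: "C2_near f x" and sd: "second_diff_le f x k"
  shows "P1_plus (hessian f x) \<le> k"
proof (rule field_le_epsilon)
  fix \<epsilon> :: real assume "\<epsilon> > 0"
  define H where "H = hessian f x"
  obtain e where e: "e \<noteq> 0" "H *v e = P1_plus H *\<^sub>R e"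
    using P1_plus_eigenvalue[OF hessian_symmetric[OF C2]] unfolding H_def by auto
  define d where "d = \<epsilon> / 3"
  have d: "d > 0" using \<open>\<epsilon> > 0\<close> by (simp add: d_def)
  obtain r1 where r1: "r1 > 0" "\<And>h. norm h < r1 \<Longrightarrow>
      \<bar>f (x + h) - f x - gradient f x \<bullet> h - (h \<bullet> (H *v h)) / 2\<bar> \<le> d * (norm h)\<^sup>2"
    using second_order_Taylor[OF C2 d] unfolding H_def by blast
  have "\<forall>\<^sub>F h in nhds 0. f (x + h) + f (x - h) - 2 * f x \<le> (norm h)\<^sup>2 * (k + d)"
    using sd d unfolding second_diff_le_def by blast
  then obtain r2 where r2: "r2 > 0" "\<And>h. norm h < r2 \<Longrightarrow>
      f (x + h) + f (x - h) - 2 * f x \<le> (norm h)\<^sup>2 * (k + d)"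
    unfolding eventually_nhds_metric by (auto simp: dist_norm)
  define h where "h = (min r1 r2 / (2 * norm e)) *\<^sub>R e"
  have "norm h = min r1 r2 / 2" using e(1) r1 r2 by (simp add: h_def)
  then have h: "norm h > 0" "norm h < r1" "norm h < r2" using r1 r2 by auto
  have "H *v h = P1_plus H *\<^sub>R h" by (simp add: h_def matrix_vector_mult_scaleR e(2))
  then have hh: "h \<bullet> (H *v h) = P1_plus H * (norm h)\<^sup>2" by (simp add: power2_norm_eq_inner)
  have "\<bar>f (x + h) - f x - gradient f x \<bullet> h - P1_plus H * (norm h)\<^sup>2 / 2\<bar> \<le> d * (norm h)\<^sup>2"
    using r1(2)[OF h(2)] unfolding hh .
  moreover have "\<bar>f (x - h) - f x + gradient f x \<bullet> h - P1_plus H * (norm h)\<^sup>2 / 2\<bar> \<le> d * (norm h)\<^sup>2"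
    using r1(2)[of "- h"] h(2) hh matrix_vector_mult_scaleR[of H "-1" h] by simp
  ultimately have "P1_plus H * (norm h)\<^sup>2 - 2 * (d * (norm h)\<^sup>2) \<le> (norm h)\<^sup>2 * (k + d)"
    using r2(2)[OF h(3)] by linarith
  then have "(norm h)\<^sup>2 * P1_plus H \<le> (norm h)\<^sup>2 * (k + 3 * d)" by (simp add: algebra_simps)
  then have "P1_plus H \<le> k + 3 * d" using h(1) by simp
  then show "P1_plus (hessian f x) \<le> k + \<epsilon>" by (simp add: d_def H_def)
qed

lemma eventually_at_within_open_nhds:
  assumes "open S" "x \<in> S" "P x" "eventually P (at x within S)"
  shows "eventually P (nhds x)"
  unfolding eventually_nhds_conv_at using assms(3,4) at_within_open[OF assms(2,1)] by auto

lemma continuous_on_imp_lsc_on: "continuous_on S f \<Longrightarrow> lsc_on S f"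
  unfolding lsc_on_def continuous_on_def using order_tendstoD(1) by fastforce

lemma continuous_on_imp_usc_on: "continuous_on S f \<Longrightarrow> usc_on S f"
  unfolding usc_on_def continuous_on_def using order_tendstoD(2) by fastforce

text \<open>A test function touching v from below inherits its second difference bound, hence the
  bound on the top eigenvalue of its Hessian.\<close>

lemma supersols_imp_visc_supersolution:
  assumes "v \<in> supersols \<Omega> \<mu> 0" and "open \<Omega>"
  shows "visc_supersolution \<Omega> \<mu> v"
  unfolding visc_supersolution_def
proof (intro conjI ballI allI impI)
  show "lsc_on \<Omega> v" using supersolsD(1)[OF assms(1)] by (rule continuous_on_imp_lsc_on)
  fix x0 \<phi> assume x0: "x0 \<in> \<Omega>" and C2: "C2_near \<phi> x0"
    and "\<forall>\<^sub>F x in at x0 within \<Omega>. v x0 - \<phi> x0 \<le> v x - \<phi> x"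
  then have ev: "\<forall>\<^sub>F x in nhds x0. v x0 - \<phi> x0 \<le> v x - \<phi> x"
    using \<open>open \<Omega>\<close> by (intro eventually_at_within_open_nhds) auto
  have "second_diff_le (\<lambda>y. v y + (\<phi> x0 - v x0)) x0 (- (\<mu> * v x0 + 0))"
    using supersolsD(3)[OF assms(1) x0] by (simp add: second_diff_le_def algebra_simps)
  then have "second_diff_le \<phi> x0 (- (\<mu> * v x0 + 0))"
    by (rule second_diff_le_touch) (use ev in \<open>auto elim: eventually_mono\<close>)
  then have "P1_plus (hessian \<phi> x0) \<le> - (\<mu> * v x0 + 0)"
    by (rule second_diff_le_imp_P1_plus_le[OF C2])
  then show "P1_plus (hessian \<phi> x0) + \<mu> * v x0 \<le> 0" by simp
qed

lemma lsc_on_attains_inf: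
  fixes f :: "'a::topological_space \<Rightarrow> real"
  assumes "compact T" "T \<noteq> {}" "lsc_on T f"
  shows "\<exists>x\<in>T. \<forall>y\<in>T. f x \<le> f y"
proof (rule ccontr)
  assume "\<not> ?thesis"
  then have "\<exists>y. y \<in> T \<and> f y < f x" if "x \<in> T" for x
    using that by (auto simp: not_le)
  then obtain w where w: "\<And>x. x \<in> T \<Longrightarrow> w x \<in> T \<and> f (w x) < f x" by metis
  have "\<exists>U. open U \<and> x \<in> U \<and> (\<forall>y\<in>U \<inter> T. f (w x) < f y)" if x: "x \<in> T" for x
  proof -
    have "\<forall>\<^sub>F y in at x within T. f (w x) < f y"
      using assms(3) w[OF x] x unfolding lsc_on_def by blast
    then obtain U where "open U" "x \<in> U" "\<And>y. y \<in> U \<Longrightarrow> y \<noteq> x \<Longrightarrow> y \<in> T \<Longrightarrow> f (w x) < f y"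
      unfolding eventually_at_topological by blast
    then show ?thesis using w[OF x] by (intro exI[of _ U]) auto
  qed
  then obtain U where U: "\<And>x. x \<in> T \<Longrightarrow> open (U x) \<and> x \<in> U x \<and> (\<forall>y\<in>U x \<inter> T. f (w x) < f y)"
    by metis
  obtain C where C: "C \<subseteq> T" "finite C" "T \<subseteq> (\<Union>c\<in>C. U c)"
    using compactE_image[OF assms(1), of T U] U by blast
  have "C \<noteq> {}" using C(3) assms(2) by auto
  \<comment> \<open>If no minimum existed, every x would have a point \<open>w x\<close> with a
    smaller value, exceeded by f near x. Taking the lowest \<open>w c\<close> of a finite cover, the
    set that covers \<open>w c\<close> itself produces a still lower one.\<close>
  define c where "c = arg_min_on (\<lambda>x. f (w x)) C"
  have c: "c \<in> C" "\<And>x. x \<in> C \<Longrightarrow> f (w c) \<le> f (w x)"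
    using arg_min_if_finite[OF C(2) \<open>C \<noteq> {}\<close>, of "\<lambda>x. f (w x)"] by (auto simp: c_def not_less)
  have wc: "w c \<in> T" using c(1) C(1) w by blast
  then obtain x where x: "x \<in> C" "w c \<in> U x" using C(3) by blast
  then have "f (w x) < f (w c)" using U[of x] C(1) wc by blast
  then show False using c(2)[OF x(1)] by simp
qed

lemma lsc_on_diff_continuous:
  assumes "lsc_on S v" "continuous_on S q" "T \<subseteq> S"
  shows "lsc_on T (\<lambda>x. v x - q x)"
  unfolding lsc_on_def
proof (intro ballI allI impI)
  fix x a assume x: "x \<in> T" and a: "a < v x - q x"
  define d where "d = (v x - q x - a) / 2"
  have d: "d > 0" using a by (simp add: d_def)
  have "x \<in> S" using x assms(3) by blast
  have "\<forall>\<^sub>F y in at x within S. v x - d < v y"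
    using assms(1) d \<open>x \<in> S\<close> unfolding lsc_on_def by (simp add: less_diff_eq)
  moreover have "\<forall>\<^sub>F y in at x within S. q y < q x + d"
    using assms(2) d \<open>x \<in> S\<close> unfolding continuous_on_def by (intro order_tendstoD(2)) auto
  ultimately have "\<forall>\<^sub>F y in at x within S. a < v y - q y"
    by eventually_elim (simp add: d_def field_simps)
  then show "\<forall>\<^sub>F y in at x within T. a < v y - q y"
    using assms(3) by (meson at_le filter_leD)
qed

text \<open>If \<open>v\<close> lay below the chord-type function at some point of the segment, then the test function
  \<open>q\<close>, which agrees with that function on the segment and drops off steeply in the directions
  orthogonal to it, would touch \<open>v\<close> from below in the interior of a thin tube, although its second
  derivative along the segment is \<open>- m > - \<mu> v\<close>.\<close>

lemma visc_supersolution_imp_chord_ineq: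
  fixes \<Omega> :: "(real^'n) set"
  assumes vs: "visc_supersolution \<Omega> \<mu> v" and "open \<Omega>" "0 \<le> \<mu>" and pos: "\<And>x. x \<in> \<Omega> \<Longrightarrow> 0 < v x"
  shows "chord_ineq \<Omega> \<mu> 0 v"
proof (rule chord_ineq_weakenI, rule ccontr)
  fix a b :: "real^'n" and m t :: real
  assume seg: "closed_segment a b \<subseteq> \<Omega>"
    and m: "\<And>y. y \<in> closed_segment a b \<Longrightarrow> m < \<mu> * v y + 0"
    and t: "0 \<le> t" "t \<le> 1"
    and "\<not> (1 - t) * v a + t * v b + m / 2 * (t * (1 - t)) * (norm (b - a))\<^sup>2
          \<le> v ((1 - t) *\<^sub>R a + t *\<^sub>R b)"
  then have neg: "v ((1 - t) *\<^sub>R a + t *\<^sub>R b) <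
      (1 - t) * v a + t * v b + m / 2 * (t * (1 - t)) * (norm (b - a))\<^sup>2" by simp
  have lsc: "lsc_on \<Omega> v" using vs by (simp add: visc_supersolution_def)
  have lsc': "\<forall>\<^sub>F y in nhds x. c < v y" if "x \<in> \<Omega>" "c < v x" for x c
    using lsc that \<open>open \<Omega>\<close> unfolding lsc_on_def by (intro eventually_at_within_open_nhds) auto
  define e where "e = b - a"
  define L where "L = (1 - t) * v a + t * v b + m / 2 * (t * (1 - t)) * (norm e)\<^sup>2"
  define y0 where "y0 = (1 - t) *\<^sub>R a + t *\<^sub>R b"
  define \<delta> where "\<delta> = (L - v y0) / 2"
  have \<delta>: "\<delta> > 0" using neg by (simp add: \<delta>_def L_def y0_def e_def)
  have "e \<noteq> 0"
  proof
    assume "e = 0"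
    then have "b = a" by (simp add: e_def)
    then have "y0 = a" "L = v a" by (simp_all add: y0_def L_def \<open>e = 0\<close> algebra_simps)
    then show False using \<delta> by (simp add: \<delta>_def)
  qed
  then have ee: "e \<bullet> e > 0" by simp
  \<comment> \<open>Half of the gap is spent on lowering the end values: near both ends v then
    exceeds \<open>q\<close>, while at \<open>y0\<close> it still lies below \<open>q\<close> by
    \<open>\<delta>\<close>.\<close>
  define \<alpha> \<beta> where "\<alpha> = v a - \<delta>" and "\<beta> = v b - \<delta>"
  \<comment> \<open>Open although v is only lower semicontinuous, because \<open>\<mu>\<close> is
    nonnegative; so a tube around the segment stays in it.\<close>
  define U where "U = {y \<in> \<Omega>. m < \<mu> * v y}"
  have "open U"
  proof (subst open_subopen, intro ballI)
    fix x assume "x \<in> U"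
    then have x: "x \<in> \<Omega>" "m < \<mu> * v x" by (auto simp: U_def)
    have "\<forall>\<^sub>F y in nhds x. m < \<mu> * v y"
    proof (cases "\<mu> = 0")
      case False
      then have "\<mu> > 0" using \<open>0 \<le> \<mu>\<close> by simp
      then have "\<forall>\<^sub>F y in nhds x. m / \<mu> < v y" using x by (intro lsc') (simp_all add: field_simps)
      then show ?thesis by eventually_elim (use \<open>\<mu> > 0\<close> in \<open>simp add: field_simps\<close>)
    qed (use x in simp)
    moreover have "\<forall>\<^sub>F y in nhds x. y \<in> \<Omega>" using x \<open>open \<Omega>\<close> eventually_nhds_in_open by blast
    ultimately have "\<forall>\<^sub>F y in nhds x. y \<in> U" by eventually_elim (simp add: U_def)
    then show "\<exists>T. open T \<and> x \<in> T \<and> T \<subseteq> U" unfolding eventually_nhds by blast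
  qed
  moreover have "closed_segment a b \<subseteq> U" using seg m by (auto simp: U_def)
  ultimately obtain \<rho>1 where \<rho>1: "\<rho>1 > 0" "(\<Union>x\<in>closed_segment a b. ball x \<rho>1) \<subseteq> U"
    using compact_subset_open_imp_ball_epsilon_subset[OF compact_segment] by blast
  have "a \<in> \<Omega>" "b \<in> \<Omega>" using seg by auto
  then have "\<forall>\<^sub>F y in nhds a. \<alpha> < v y" "\<forall>\<^sub>F y in nhds b. \<beta> < v y"
    using \<delta> by (auto intro!: lsc' simp: \<alpha>_def \<beta>_def)
  then obtain \<rho>2 \<rho>3 where \<rho>2: "\<rho>2 > 0" "\<And>y. dist y a < \<rho>2 \<Longrightarrow> \<alpha> < v y"
    and \<rho>3: "\<rho>3 > 0" "\<And>y. dist y b < \<rho>3 \<Longrightarrow> \<beta> < v y"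
    unfolding eventually_nhds_metric by blast
  define \<rho> where "\<rho> = min \<rho>1 (min \<rho>2 \<rho>3) / 2"
  have \<rho>: "\<rho> > 0" "\<rho> < \<rho>1" "\<rho> < \<rho>2" "\<rho> < \<rho>3" using \<rho>1(1) \<rho>2(1) \<rho>3(1) by (auto simp: \<rho>_def)
  \<comment> \<open>Coordinates of the tube: \<open>s\<close> is the parameter along the segment,
    and \<open>z\<close> is the component orthogonal to it.\<close>
  define s where "s y = ((y - a) \<bullet> e) / (e \<bullet> e)" for y
  define z where "z y = y - a - s y *\<^sub>R e" for y
  have yeq: "y = (a + s y *\<^sub>R e) + z y" for y by (simp add: z_def)
  have cont_s: "continuous_on UNIV s" unfolding s_def using ee by (intro continuous_intros) simp
  have cont_z: "continuous_on UNIV z" unfolding z_def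
    by (intro continuous_intros cont_s)
  define T where "T = {y. 0 \<le> s y \<and> s y \<le> 1 \<and> norm (z y) \<le> \<rho>}"
  have "closed T"
    unfolding T_def by (intro closed_Collect_conj closed_Collect_le continuous_intros cont_s cont_z)
  moreover have "bounded T"
  proof (rule boundedI)
    fix y assume "y \<in> T"
    then have y: "0 \<le> s y" "s y \<le> 1" "norm (z y) \<le> \<rho>" by (auto simp: T_def)
    have "norm y \<le> norm a + norm (s y *\<^sub>R e) + norm (z y)"
      by (subst yeq[of y]) (intro order_trans[OF norm_triangle_ineq] add_mono norm_triangle_ineq order_refl)
    also have "norm (s y *\<^sub>R e) \<le> norm e" using y by (simp add: mult_left_le_one_le)
    finally show "norm y \<le> norm a + norm e + \<rho>" using y by simp
  qed
  ultimately have "compact T" using compact_eq_bounded_closed by blast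
  have TU: "T \<subseteq> U"
  proof
    fix y assume "y \<in> T"
    then have y: "0 \<le> s y" "s y \<le> 1" "norm (z y) \<le> \<rho>" by (auto simp: T_def)
    have "a + s y *\<^sub>R e \<in> closed_segment a b"
      unfolding in_segment e_def using y by (intro exI[of _ "s y"]) (simp add: algebra_simps)
    moreover have "y \<in> ball (a + s y *\<^sub>R e) \<rho>1"
      using y \<rho> by (simp add: dist_norm z_def norm_minus_commute algebra_simps)
    ultimately show "y \<in> U" using \<rho>1(2) by blast
  qed
  then have T\<Omega>: "T \<subseteq> \<Omega>" by (auto simp: U_def)
  \<comment> \<open>\<open>M\<close> bounds the chord part of \<open>q\<close> on the tube, and
    \<open>K * \<rho>\<^sup>2 = M + 1\<close> pushes \<open>q\<close> to at most -1 on the lateral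
    boundary, below the positive v.\<close>
  define M where "M = \<bar>\<alpha>\<bar> + \<bar>\<beta>\<bar> + \<bar>m / 2\<bar> * (e \<bullet> e)"
  define K where "K = (M + 1) / \<rho>\<^sup>2"
  \<comment> \<open>The Hessian of \<open>q\<close>: eigenvalue - m along \<open>e\<close> and - 2K
    on the orthogonal complement. The slope \<open>p\<close> is then the one for which
    \<open>q\<close> runs from \<open>\<alpha>\<close> to \<open>\<beta>\<close> on the
    segment.\<close>
  define F where "F d = (- m * (d \<bullet> e / (e \<bullet> e))) *\<^sub>R e - (2 * K) *\<^sub>R (d - (d \<bullet> e / (e \<bullet> e)) *\<^sub>R e)" for d
  define p where "p = ((\<beta> - \<alpha>) / (e \<bullet> e) + m / 2) *\<^sub>R e"
  define q where "q y = \<alpha> + p \<bullet> (y - a) + ((y - a) \<bullet> F (y - a)) / 2" for y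
  have linF: "linear F"
    by (rule linearI) (simp_all add: F_def inner_add_left add_divide_distrib algebra_simps)
  have symF: "u \<bullet> F w = w \<bullet> F u" for u w
    by (simp add: F_def inner_diff_right inner_commute algebra_simps)
  have zz: "(norm (z y))\<^sup>2 = (norm (y - a))\<^sup>2 - (s y)\<^sup>2 * (e \<bullet> e)" for y
  proof -
    have "(y - a) \<bullet> e = s y * (e \<bullet> e)" using ee by (simp add: s_def)
    moreover have "(norm (d - c *\<^sub>R e))\<^sup>2 = (norm d)\<^sup>2 - 2 * c * (d \<bullet> e) + c\<^sup>2 * (e \<bullet> e)" for d c
      unfolding power2_norm_eq_inner
      by (simp add: inner_diff_left inner_diff_right inner_commute power2_eq_square algebra_simps)
    ultimately show ?thesis unfolding z_def by (simp only:) (simp add: power2_eq_square)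
  qed
  have q_eq: "q y = (1 - s y) * \<alpha> + s y * \<beta> + m / 2 * (s y * (1 - s y)) * (e \<bullet> e) - K * (norm (z y))\<^sup>2" for y
  proof -
    have ye: "(y - a) \<bullet> e = s y * (e \<bullet> e)" using ee by (simp add: s_def)
    have "p \<bullet> (y - a) = ((\<beta> - \<alpha>) / (e \<bullet> e) + m / 2) * (s y * (e \<bullet> e))"
      unfolding p_def ye[symmetric] by (simp add: inner_commute[of "y - a" e])
    also have "\<dots> = s y * (\<beta> - \<alpha>) + m / 2 * (s y * (e \<bullet> e))" using ee by (simp add: field_simps)
    finally have 1: "p \<bullet> (y - a) = s y * (\<beta> - \<alpha>) + m / 2 * (s y * (e \<bullet> e))" .
    have "F (y - a) = (- m * s y) *\<^sub>R e - (2 * K) *\<^sub>R ((y - a) - s y *\<^sub>R e)"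
      by (simp add: F_def s_def)
    moreover have "d \<bullet> (x *\<^sub>R e - (2 * K) *\<^sub>R (d - c *\<^sub>R e)) = x * (d \<bullet> e) - 2 * K * ((norm d)\<^sup>2 - c * (d \<bullet> e))" for d x c
      unfolding power2_norm_eq_inner by (simp add: inner_diff_right)
    ultimately have 2: "(y - a) \<bullet> F (y - a) = - m * (s y)\<^sup>2 * (e \<bullet> e) - 2 * K * ((norm (y - a))\<^sup>2 - (s y)\<^sup>2 * (e \<bullet> e))"
      using ye by (simp only:) (simp add: power2_eq_square)
    show ?thesis unfolding q_def 1 2 zz by (simp add: field_simps power2_eq_square)
  qed
  have contq: "continuous_on \<Omega> q"
    unfolding q_eq by (intro continuous_intros continuous_on_subset[OF cont_s] continuous_on_subset[OF cont_z]) auto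
  have sy0: "s y0 = t" and zy0: "z y0 = 0"
  proof -
    have *: "y0 - a = t *\<^sub>R e" by (simp add: y0_def e_def algebra_simps)
    show "s y0 = t" using ee by (simp add: s_def *)
    then show "z y0 = 0" by (simp add: z_def *)
  qed
  then have "y0 \<in> T" using t \<rho> by (simp add: T_def)
  have "q y0 = L - \<delta>" unfolding q_eq sy0 zy0 by (simp add: L_def \<alpha>_def \<beta>_def power2_norm_eq_inner algebra_simps)
  then have neg0: "v y0 - q y0 < 0" using \<delta> by (simp add: \<delta>_def field_simps)
  obtain y1 where y1: "y1 \<in> T" and min: "\<And>y. y \<in> T \<Longrightarrow> v y1 - q y1 \<le> v y - q y"
    using lsc_on_attains_inf[OF \<open>compact T\<close> _ lsc_on_diff_continuous[OF lsc contq T\<Omega>]] \<open>y0 \<in> T\<close> by blast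
  have neg1: "v y1 < q y1" using min[OF \<open>y0 \<in> T\<close>] neg0 by linarith
  have "y1 \<in> \<Omega>" using y1 T\<Omega> by blast
  have "M \<ge> 0" unfolding M_def by simp
  then have "K > 0" using \<rho> by (simp add: K_def)
  have sT: "0 \<le> s y1" "s y1 \<le> 1" "norm (z y1) \<le> \<rho>" using y1 by (auto simp: T_def)
  \<comment> \<open>The minimum of v - q is negative, whereas v exceeds \<open>q\<close> on both end
    faces and on the lateral boundary; so it is attained in the open tube.\<close>
  have "s y1 \<noteq> 0"
  proof
    assume s0: "s y1 = 0"
    then have "dist y1 a < \<rho>2" using sT \<rho> by (simp add: dist_norm z_def)
    moreover have "q y1 \<le> \<alpha>" using \<open>K > 0\<close> unfolding q_eq s0 by simp
    ultimately show False using \<rho>2(2) neg1 by fastforce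
  qed
  moreover have "s y1 \<noteq> 1"
  proof
    assume s0: "s y1 = 1"
    then have "dist y1 b < \<rho>3" using sT \<rho> by (simp add: dist_norm z_def e_def)
    moreover have "q y1 \<le> \<beta>" using \<open>K > 0\<close> unfolding q_eq s0 by simp
    ultimately show False using \<rho>3(2) neg1 by fastforce
  qed
  moreover have "norm (z y1) \<noteq> \<rho>"
  proof
    assume "norm (z y1) = \<rho>"
    then have "K * (norm (z y1))\<^sup>2 = M + 1" using \<rho> by (simp add: K_def)
    moreover have "(1 - s y1) * \<alpha> \<le> \<bar>\<alpha>\<bar>" "s y1 * \<beta> \<le> \<bar>\<beta>\<bar>" 
      using sT by (smt (verit) abs_ge_self mult_left_le_one_le mult_left_mono abs_ge_zero)+
    moreover have "s y1 * (1 - s y1) \<le> 1" using sT by (simp add: mult_le_one)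
    then have "m / 2 * (s y1 * (1 - s y1)) \<le> \<bar>m / 2\<bar>"
      using sT by (smt (verit) abs_ge_self mult_left_le mult_right_mono abs_ge_zero mult_nonneg_nonneg)
    then have "m / 2 * (s y1 * (1 - s y1)) * (e \<bullet> e) \<le> \<bar>m / 2\<bar> * (e \<bullet> e)"
      using ee by (intro mult_right_mono) auto
    ultimately have "q y1 \<le> -1" unfolding q_eq M_def by linarith
    then show False using neg1 pos[OF \<open>y1 \<in> \<Omega>\<close>] by simp
  qed
  ultimately have int: "0 < s y1" "s y1 < 1" "norm (z y1) < \<rho>" using sT by auto
  have "open {y. 0 < s y \<and> s y < 1 \<and> norm (z y) < \<rho>}"
    by (intro open_Collect_conj open_Collect_less continuous_intros cont_s cont_z)
  then have "\<forall>\<^sub>F y in nhds y1. y \<in> {y. 0 < s y \<and> s y < 1 \<and> norm (z y) < \<rho>}"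
    using int by (intro eventually_nhds_in_open) auto
  then have "\<forall>\<^sub>F y in nhds y1. v y - q y \<ge> v y1 - q y1"
    by eventually_elim (rule min, auto simp: T_def)
  then have "\<forall>\<^sub>F y in at y1 within \<Omega>. v y - q y \<ge> v y1 - q y1"
    unfolding eventually_at_filter by (rule eventually_mono) simp
  moreover have "C2_near q y1" unfolding q_def by (rule C2_near_quadratic[OF linF symF])
  ultimately have "P1_plus (hessian q y1) + \<mu> * v y1 \<le> 0"
    using vs \<open>y1 \<in> \<Omega>\<close> unfolding visc_supersolution_def by blast
  moreover have "hessian q y1 = matrix F"
    unfolding q_def by (rule hessian_quadratic[OF linF symF])
  moreover have "matrix F *v w = F w" for w
    using matrix_vector_mul(2)[OF linF] by (rule fun_cong)
  moreover have "F e = (- m) *\<^sub>R e" using ee by (simp add: F_def)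
  \<comment> \<open>\<open>P1_plus\<close> dominates the eigenvalue - m of the direction
    \<open>e\<close>, however negative the other ones are.\<close>
  ultimately have "- m + \<mu> * v y1 \<le> 0"
    using eigenvalue_le_P1_plus[of "matrix F" e "- m"] symF \<open>e \<noteq> 0\<close> by simp
  then show False using TU y1 by (auto simp: U_def)
qed

section \<open>Strictly convex domains\<close>

lemma second_diff_le_min:
  assumes "v x \<le> w x \<Longrightarrow> second_diff_le v x k" and "w x \<le> v x \<Longrightarrow> second_diff_le w x k"
  shows "second_diff_le (\<lambda>y. min (v y) (w y)) x k"
proof (cases "v x \<le> w x")
  case True
  then show ?thesis using second_diff_le_touch[OF assms(1)] by (simp add: min_def)
next
  case False
  then show ?thesis using second_diff_le_touch[OF assms(2)] by (simp add: min_def)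
qed

text \<open>A chord of half-length \<open>R\<close> centred at x already forces \<open>v x\<close>
  to be at least \<open>g * R\<^sup>2 / 2\<close>.\<close>

lemma supersols_pos:
  fixes \<Omega> :: "'a::euclidean_space set"
  assumes v: "v \<in> supersols \<Omega> \<mu> g" and "open \<Omega>" "0 \<le> \<mu>" "0 < g" and x: "x \<in> \<Omega>"
  shows "0 < v x"
proof -
  obtain R where R: "R > 0" "cball x R \<subseteq> \<Omega>" using assms open_contains_cball by blast
  obtain h :: 'a where h: "norm h = R" using vector_choose_size[of R] R by auto
  have seg: "closed_segment (x - h) (x + h) \<subseteq> \<Omega>"
    using R(2) h by (intro order_trans[OF closed_segment_subset R(2)]) (auto simp: dist_norm)
  have "g \<le> \<mu> * v y + g" if "y \<in> closed_segment (x - h) (x + h)" for y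
    using that seg supersolsD(2)[OF v] \<open>0 \<le> \<mu>\<close> by (simp add: subset_iff)
  then have "v (x + h) + v (x - h) - 2 * v x \<le> - g * (norm h)\<^sup>2"
    by (rule chord_ineq_midpoint[OF supersols_chord_ineq[OF v] seg])
  moreover have "0 \<le> v (x + h)" "0 \<le> v (x - h)"
    using R h by (auto intro!: supersolsD(2)[OF v] simp: subset_iff dist_norm)
  moreover have "0 < g * (norm h)\<^sup>2" using h R \<open>0 < g\<close> by simp
  ultimately show ?thesis by (simp only: mult_minus_left)
qed

lemma continuous_on_closure_zero_extension:
  fixes v :: "'a::metric_space \<Rightarrow> real"
  assumes "open \<Omega>" and cont: "continuous_on \<Omega> v"
    and bd: "\<And>z \<epsilon>. z \<in> frontier \<Omega> \<Longrightarrow> 0 < \<epsilon> \<Longrightarrow> \<exists>d>0. \<forall>y\<in>\<Omega>. dist y z < d \<longrightarrow> \<bar>v y\<bar> < \<epsilon>"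
  shows "continuous_on (closure \<Omega>) (\<lambda>x. if x \<in> \<Omega> then v x else 0)"
  unfolding continuous_on_iff
proof (intro ballI allI impI)
  fix x and \<epsilon> :: real assume x: "x \<in> closure \<Omega>" and \<epsilon>: "0 < \<epsilon>"
  show "\<exists>d>0. \<forall>x'\<in>closure \<Omega>. dist x' x < d \<longrightarrow>
      dist (if x' \<in> \<Omega> then v x' else 0) (if x \<in> \<Omega> then v x else 0) < \<epsilon>"
  proof (cases "x \<in> \<Omega>")
    case True
    obtain d1 where d1: "d1 > 0" "\<And>y. y \<in> \<Omega> \<Longrightarrow> dist y x < d1 \<Longrightarrow> dist (v y) (v x) < \<epsilon>"
      using cont True \<epsilon> unfolding continuous_on_iff by metis
    obtain d2 where d2: "d2 > 0" "\<And>y. dist y x < d2 \<Longrightarrow> y \<in> \<Omega>"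
      using \<open>open \<Omega>\<close> True unfolding open_dist by metis
    show ?thesis using d1 d2 True by (intro exI[of _ "min d1 d2"]) auto
  next
    case False
    then have "x \<in> frontier \<Omega>" using x \<open>open \<Omega>\<close> by (simp add: frontier_def interior_open)
    then obtain d where "d > 0" "\<And>y. y \<in> \<Omega> \<Longrightarrow> dist y x < d \<Longrightarrow> \<bar>v y\<bar> < \<epsilon>"
      using bd \<epsilon> by metis
    then show ?thesis using False \<epsilon> by (intro exI[of _ d]) auto
  qed
qed

locale strictly_convex_domain =
  fixes \<Omega> :: "(real^'n) set"
  assumes open_dom: "open \<Omega>" and nonempty_dom: "\<Omega> \<noteq> {}"
    and bounded_dom: "bounded \<Omega>" and strictly_convex_dom: "strictly_convex \<Omega>"
begin

lemma convex_dom: "convex \<Omega>"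
proof (rule convexI)
  fix x y and u v :: real assume *: "x \<in> \<Omega>" "y \<in> \<Omega>" "0 \<le> u" "0 \<le> v" "u + v = 1"
  then have u: "u = 1 - v" by simp
  consider "x = y" | "v = 0" | "v = 1" | "x \<noteq> y" "0 < v" "v < 1" using * by fastforce
  then show "u *\<^sub>R x + v *\<^sub>R y \<in> \<Omega>"
  proof cases
    case 1
    then show ?thesis using * by (simp flip: scaleR_left_distrib)
  next
    case 4
    then show ?thesis using strictly_convex_dom * closure_subset unfolding strictly_convex_def u
      by blast
  qed (use * u in auto)
qed

lemma supersols_concave:
  assumes "v \<in> supersols \<Omega> \<mu> g" "0 \<le> \<mu>" "0 \<le> g"
  shows "concave_on \<Omega> v"
  by (rule chord_ineq_imp_concave[OF supersols_chord_ineq[OF assms(1)] convex_dom supersolsD(2)[OF assms(1)] assms(2,3)])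

lemma supersols_bdd_above:
  assumes "v \<in> supersols \<Omega> \<mu> g" "0 \<le> \<mu>" "0 \<le> g"
  shows "bdd_above (v ` \<Omega>)"
  by (rule concave_bdd_above[OF supersols_concave[OF assms] supersolsD(2)[OF assms(1)] open_dom bounded_dom])

section \<open>Supporting hyperplanes, boundary barriers and the torsion function\<close>

lemma strict_support:
  assumes z: "z \<in> frontier \<Omega>"
  obtains a where "\<And>x. x \<in> closure \<Omega> \<Longrightarrow> x \<noteq> z \<Longrightarrow> 0 < a \<bullet> (x - z)"
proof -
  have z_notin: "z \<notin> \<Omega>" and z_cl: "z \<in> closure \<Omega>"
    using z open_dom by (auto simp: frontier_def interior_open)
  obtain a b where a: "a \<noteq> 0" "a \<bullet> z \<le> b" "\<And>x. x \<in> \<Omega> \<Longrightarrow> b \<le> a \<bullet> x"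
    using separating_hyperplane_sets[of "{z}" \<Omega>] convex_dom nonempty_dom z_notin by auto
  have ge: "a \<bullet> z \<le> a \<bullet> x" if "x \<in> \<Omega>" for x using a(2) a(3)[OF that] by simp
  have cl: "a \<bullet> z \<le> a \<bullet> x" if "x \<in> closure \<Omega>" for x
  proof -
    have "closure \<Omega> \<subseteq> {x. a \<bullet> z \<le> a \<bullet> x}"
      using ge closed_halfspace_ge[of "a \<bullet> z" a] by (intro closure_minimal) auto
    then show ?thesis using that by blast
  qed
  show thesis
  proof (rule that[of a], rule ccontr)
    fix x assume x: "x \<in> closure \<Omega>" "x \<noteq> z" and "\<not> 0 < a \<bullet> (x - z)"
    then have eq: "a \<bullet> x = a \<bullet> z" using cl[OF x(1)] by (simp add: inner_diff_right)
    \<comment> \<open>Strict convexity enters here: the midpoint lies in the open domain, yet the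
      supporting functional would attain its minimum there, which a small step along - a
      refutes.\<close>
    define y where "y = (1 - 1 / 2) *\<^sub>R x + (1 / 2 :: real) *\<^sub>R z"
    have "y \<in> \<Omega>" using strictly_convex_dom x z_cl
      unfolding strictly_convex_def y_def by (metis field_sum_of_halves half_gt_zero_iff less_add_same_cancel1 zero_less_one)
    then obtain R where R: "R > 0" "cball y R \<subseteq> \<Omega>" using open_dom open_contains_cball by blast
    define w where "w = y - (R / norm a) *\<^sub>R a"
    have "w \<in> cball y R" using a(1) R by (simp add: w_def dist_norm)
    then have "a \<bullet> z \<le> a \<bullet> w" using R ge by blast
    moreover have "a \<bullet> y = a \<bullet> z" by (simp add: y_def inner_add_right eq)
    then have "a \<bullet> w = a \<bullet> z - R / norm a * (a \<bullet> a)" by (simp add: w_def inner_diff_right)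
    moreover have "R / norm a * (a \<bullet> a) > 0" using R a(1) by simp
    ultimately show False by linarith
  qed
qed

text \<open>Only nonnegativity has to be arranged. Where the quadratic term is below
  \<open>\<eta>\<close> the constant suffices; the remaining part of the closure is compact and
  avoids z, so the strict support is bounded away from 0 there and a large multiple of it
  compensates.\<close>

lemma quadratic_barrier:
  assumes z: "z \<in> frontier \<Omega>" and \<eta>: "0 < \<eta>"
  obtains p where "(\<lambda>x. \<eta> + p \<bullet> (x - z) + (- 1) / 2 * (norm (x - z))\<^sup>2) \<in> supersols \<Omega> 0 1"
proof -
  obtain a where a: "\<And>x. x \<in> closure \<Omega> \<Longrightarrow> x \<noteq> z \<Longrightarrow> 0 < a \<bullet> (x - z)"
    using strict_support[OF z] by blast
  have a0: "0 \<le> a \<bullet> (x - z)" if "x \<in> closure \<Omega>" for x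
    using a[OF that] by (cases "x = z") auto
  define C where "C = closure \<Omega> \<inter> {x. \<eta> \<le> (norm (x - z))\<^sup>2 / 2}"
  have "closed {x. \<eta> \<le> (norm (x - z))\<^sup>2 / 2}"
    by (intro closed_Collect_le continuous_intros) auto
  then have "compact C" unfolding C_def
    using bounded_dom by (intro compact_Int_closed) auto
  obtain D where D: "\<And>x. x \<in> \<Omega> \<Longrightarrow> norm (x - z) \<le> D"
    using bounded_any_center[of \<Omega> z] bounded_dom by (auto simp: dist_norm norm_minus_commute)
  obtain M where M: "0 \<le> M" "\<And>x. x \<in> C \<Longrightarrow> D\<^sup>2 / 2 \<le> M * (a \<bullet> (x - z))"
  proof (cases "C = {}")
    case False
    have "continuous_on C (\<lambda>x. a \<bullet> (x - z))" by (intro continuous_intros)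
    then obtain y where y: "y \<in> C" "\<And>x. x \<in> C \<Longrightarrow> a \<bullet> (y - z) \<le> a \<bullet> (x - z)"
      using continuous_attains_inf[OF \<open>compact C\<close> False] by blast
    have "y \<noteq> z" using y(1) \<eta> by (auto simp: C_def)
    then have pos: "0 < a \<bullet> (y - z)" using a y(1) by (simp add: C_def)
    define M where "M = D\<^sup>2 / 2 / (a \<bullet> (y - z))"
    have "M \<ge> 0" using pos by (simp add: M_def)
    moreover have "D\<^sup>2 / 2 \<le> M * (a \<bullet> (x - z))" if "x \<in> C" for x
    proof -
      have "D\<^sup>2 / 2 = M * (a \<bullet> (y - z))" using pos by (simp add: M_def)
      also have "\<dots> \<le> M * (a \<bullet> (x - z))" using y(2)[OF that] \<open>M \<ge> 0\<close> by (rule mult_left_mono)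
      finally show ?thesis .
    qed
    ultimately show thesis by (rule that)
  qed (use that[of 0] in simp)
  show thesis
  proof (rule that[of "M *\<^sub>R a"], rule supersolsI)
    show "continuous_on \<Omega> (\<lambda>x. \<eta> + (M *\<^sub>R a) \<bullet> (x - z) + (- 1) / 2 * (norm (x - z))\<^sup>2)"
      by (intro continuous_intros)
    show "second_diff_le (\<lambda>x. \<eta> + (M *\<^sub>R a) \<bullet> (x - z) + (- 1) / 2 * (norm (x - z))\<^sup>2) x
        (- (0 * (\<eta> + (M *\<^sub>R a) \<bullet> (x - z) + (- 1) / 2 * (norm (x - z))\<^sup>2) + 1))" for x
      using second_diff_le_quadratic[of \<eta> "M *\<^sub>R a" z "- 1" x] by simp
    fix x assume x: "x \<in> \<Omega>"
    then have xc: "x \<in> closure \<Omega>" using closure_subset by blast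
    show "0 \<le> \<eta> + (M *\<^sub>R a) \<bullet> (x - z) + (- 1) / 2 * (norm (x - z))\<^sup>2"
    proof (cases "x \<in> C")
      case True
      have "(norm (x - z))\<^sup>2 \<le> D\<^sup>2" using D[OF x] by (simp add: power_mono)
      then show ?thesis using M(2)[OF True] \<eta> by simp
    next
      case False
      then have "(norm (x - z))\<^sup>2 / 2 < \<eta>" using xc by (auto simp: C_def)
      moreover have "0 \<le> M * (a \<bullet> (x - z))" using M(1) a0[OF xc] by simp
      ultimately show ?thesis by simp
    qed
  qed
qed

text \<open>The analogue of the torsion function for this operator. It bounds
  \<open>mu1_plus\<close> from below, supplies the right-hand side near the boundary and is the
  barrier for the normalized sequence.\<close>

definition torsion :: "real^'n \<Rightarrow> real" where
  "torsion = least_supersol \<Omega> 0 1"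

lemma torsion_mem: "torsion \<in> supersols \<Omega> 0 1"
  unfolding torsion_def
proof (rule least_supersol_mem[OF _ open_dom convex_dom])
  obtain D where D: "\<And>x. x \<in> \<Omega> \<Longrightarrow> norm x \<le> D"
    using bounded_dom unfolding bounded_iff by blast
  \<comment> \<open>The paraboloid \<open>(D\<^sup>2 - (norm x)\<^sup>2) / 2\<close>, spelled in the
    shape of \<open>second_diff_le_quadratic\<close>.\<close>
  have "(\<lambda>x. D\<^sup>2 / 2 + 0 \<bullet> (x - 0) + (- 1) / 2 * (norm (x - 0))\<^sup>2) \<in> supersols \<Omega> 0 1"
  proof (rule supersolsI)
    show "0 \<le> D\<^sup>2 / 2 + 0 \<bullet> (x - 0) + - 1 / 2 * (norm (x - 0))\<^sup>2" if "x \<in> \<Omega>" for x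
      using power_mono[OF D[OF that], of 2] by simp
    show "second_diff_le (\<lambda>x. D\<^sup>2 / 2 + 0 \<bullet> (x - 0) + - 1 / 2 * (norm (x - 0))\<^sup>2) x
        (- (0 * (D\<^sup>2 / 2 + 0 \<bullet> (x - 0) + - 1 / 2 * (norm (x - 0))\<^sup>2) + 1))" for x :: "real^'n"
      using second_diff_le_quadratic[of "D\<^sup>2 / 2" 0 0 "- 1" x] by simp
  qed (intro continuous_intros)
  then show "supersols \<Omega> 0 1 \<noteq> {}" by blast
qed auto

lemma torsion_pos: "x \<in> \<Omega> \<Longrightarrow> 0 < torsion x"
  using supersols_pos[OF torsion_mem open_dom] by simp

lemma torsion_boundary:
  assumes z: "z \<in> frontier \<Omega>" and \<epsilon>: "0 < \<epsilon>"
  shows "\<exists>d>0. \<forall>y\<in>\<Omega>. dist y z < d \<longrightarrow> \<bar>torsion y\<bar> < \<epsilon>"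
proof -
  have "0 < \<epsilon> / 2" using \<epsilon> by simp
  then obtain p where p: "(\<lambda>x. \<epsilon> / 2 + p \<bullet> (x - z) + (- 1) / 2 * (norm (x - z))\<^sup>2) \<in> supersols \<Omega> 0 1"
    using quadratic_barrier[OF z] by blast
  have "((\<lambda>x. \<epsilon> / 2 + p \<bullet> (x - z) + (- 1) / 2 * (norm (x - z))\<^sup>2) \<longlongrightarrow>
      \<epsilon> / 2 + p \<bullet> (z - z) + (- 1) / 2 * (norm (z - z))\<^sup>2) (nhds z)"
    by (intro tendsto_intros filterlim_ident)
  then have "\<forall>\<^sub>F x in nhds z. \<epsilon> / 2 + p \<bullet> (x - z) + (- 1) / 2 * (norm (x - z))\<^sup>2 < \<epsilon>"
    by (rule order_tendstoD(2)) (use \<epsilon> in simp)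
  then obtain d where d: "d > 0"
      "\<And>y. dist y z < d \<Longrightarrow> \<epsilon> / 2 + p \<bullet> (y - z) + (- 1) / 2 * (norm (y - z))\<^sup>2 < \<epsilon>"
    unfolding eventually_nhds_metric by blast
  show ?thesis
  proof (intro exI conjI ballI impI)
    fix y assume y: "y \<in> \<Omega>" "dist y z < d"
    have "torsion y \<le> \<epsilon> / 2 + p \<bullet> (y - z) + (- 1) / 2 * (norm (y - z))\<^sup>2"
      unfolding torsion_def by (rule least_supersol_le[OF p y(1)])
    then show "\<bar>torsion y\<bar> < \<epsilon>" using d(2)[OF y(2)] torsion_pos[OF y(1)] by simp
  qed (rule d(1))
qed

lemma torsion_bound:
  obtains B where "0 < B" "\<And>x. x \<in> \<Omega> \<Longrightarrow> torsion x \<le> B"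
proof -
  obtain B where B: "\<And>x. x \<in> \<Omega> \<Longrightarrow> torsion x \<le> B"
    using supersols_bdd_above[OF torsion_mem] by (auto simp: bdd_above_def)
  then show thesis by (intro that[of "max 1 B"]) (auto intro: max.coboundedI2)
qed

section \<open>The set of parameters whose supremum is \<open>mu1_plus\<close>\<close>

lemma supersol_parameter_bound:
  obtains B where "\<And>\<mu> v. v \<in> supersols \<Omega> \<mu> 0 \<Longrightarrow> (\<And>x. x \<in> \<Omega> \<Longrightarrow> 0 < v x) \<Longrightarrow> 0 \<le> \<mu> \<Longrightarrow> \<mu> \<le> B"
proof -
  obtain c where c: "c \<in> \<Omega>" using nonempty_dom by blast
  obtain R where R: "R > 0" "cball c R \<subseteq> \<Omega>" using c open_dom open_contains_cball by blast
  obtain h :: "real^'n" where h: "norm h = R / 2" using vector_choose_size[of "R / 2"] R by auto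
  \<comment> \<open>By reflection v is at least \<open>v c / 2\<close> on a chord of half-length R/2
    centred at c, so \<open>\<mu> * v c / 2\<close> is an admissible \<open>m\<close>. The midpoint
    inequality then gives \<open>\<mu> * v c / 2 * (R / 2)\<^sup>2 \<le> 2 * v c\<close>, the source
    of 16.\<close>
  show thesis
  proof (rule that[of "16 / R\<^sup>2"])
    fix \<mu> v assume v: "v \<in> supersols \<Omega> \<mu> 0" and pos: "\<And>x. x \<in> \<Omega> \<Longrightarrow> 0 < v x" and "0 \<le> \<mu>"
    have conc: "concave_on \<Omega> v" using supersols_concave[OF v \<open>0 \<le> \<mu>\<close>] by simp
    have seg: "closed_segment (c - h) (c + h) \<subseteq> cball c (R / 2)"
      using h by (intro closed_segment_subset) (auto simp: dist_norm)
    have "\<mu> * v c / 2 \<le> \<mu> * v y + 0" if y: "y \<in> closed_segment (c - h) (c + h)" for y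
    proof -
      have "dist c y \<le> R / 2" using seg y by auto
      moreover have "dist c (y - 1 *\<^sub>R (c - y)) = 2 * dist c y"
      proof -
        have "c - (y - 1 *\<^sub>R (c - y)) = 2 *\<^sub>R (c - y)" by (simp add: scaleR_2)
        then show ?thesis by (simp add: dist_norm del: scaleR_one)
      qed
      ultimately have "y - 1 *\<^sub>R (c - y) \<in> \<Omega>" using R(2) by (auto simp: subset_iff)
      then have "1 * v c \<le> (1 + 1) * v y"
        using pos by (intro concave_reflect[OF conc _ c]) (auto intro: less_imp_le)
      then have "\<mu> * v c \<le> \<mu> * (2 * v y)" using \<open>0 \<le> \<mu>\<close> by (intro mult_left_mono) auto
      then show ?thesis by simp
    qed
    moreover have "closed_segment (c - h) (c + h) \<subseteq> \<Omega>"
      using R(1) by (intro order_trans[OF seg order_trans[OF subset_cball R(2)]]) simp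
    ultimately have "v (c + h) + v (c - h) - 2 * v c \<le> - (\<mu> * v c / 2) * (norm h)\<^sup>2"
      by (intro chord_ineq_midpoint[OF supersols_chord_ineq[OF v]])
    moreover have "0 < v (c + h)" "0 < v (c - h)"
      using R h by (auto intro!: pos simp: subset_iff dist_norm)
    ultimately have "\<mu> * v c / 2 * (R / 2)\<^sup>2 \<le> 2 * v c" using h by simp
    then have "v c * (\<mu> * R\<^sup>2) \<le> v c * 16" by (simp add: power2_eq_square algebra_simps)
    then have "\<mu> * R\<^sup>2 \<le> 16" using pos[OF c] by simp
    then show "\<mu> \<le> 16 / R\<^sup>2" using R by (simp add: field_simps)
  qed
qed

text \<open>Trades the merely lower semicontinuous competitors in the definition of
  \<open>mu1_plus\<close> for continuous concave ones.\<close>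

lemma visc_supersolution_iff_supersols:
  assumes "0 \<le> \<mu>" and pos: "\<And>x. x \<in> \<Omega> \<Longrightarrow> 0 < v x"
  shows "visc_supersolution \<Omega> \<mu> v \<longleftrightarrow> v \<in> supersols \<Omega> \<mu> 0"
proof
  assume "visc_supersolution \<Omega> \<mu> v"
  then have "chord_ineq \<Omega> \<mu> 0 v"
    by (rule visc_supersolution_imp_chord_ineq[OF _ open_dom assms])
  then show "v \<in> supersols \<Omega> \<mu> 0"
    by (rule chord_ineq_imp_supersols[OF _ open_dom convex_dom less_imp_le[OF pos] assms(1) order_refl])
qed (rule supersols_imp_visc_supersolution[OF _ open_dom])

lemma le_mu1_plus:
  assumes v: "v \<in> supersols \<Omega> \<mu> 0" and pos: "\<And>x. x \<in> \<Omega> \<Longrightarrow> 0 < v x"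
  shows "\<mu> \<le> mu1_plus \<Omega>"
  unfolding mu1_plus_def
proof (rule cSup_upper)
  show "\<mu> \<in> {\<mu>. \<exists>\<phi>. (\<forall>x\<in>\<Omega>. 0 < \<phi> x) \<and> visc_supersolution \<Omega> \<mu> \<phi>}"
    using v pos supersols_imp_visc_supersolution[OF v open_dom] by blast
  obtain B where B: "\<And>\<mu> v. v \<in> supersols \<Omega> \<mu> 0 \<Longrightarrow> (\<And>x. x \<in> \<Omega> \<Longrightarrow> 0 < v x) \<Longrightarrow> 0 \<le> \<mu> \<Longrightarrow> \<mu> \<le> B"
    using supersol_parameter_bound by blast
  show "bdd_above {\<mu>. \<exists>\<phi>. (\<forall>x\<in>\<Omega>. 0 < \<phi> x) \<and> visc_supersolution \<Omega> \<mu> \<phi>}"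
  proof (rule bdd_aboveI)
    fix \<nu> assume "\<nu> \<in> {\<mu>. \<exists>\<phi>. (\<forall>x\<in>\<Omega>. 0 < \<phi> x) \<and> visc_supersolution \<Omega> \<mu> \<phi>}"
    then obtain \<phi> where "\<And>x. x \<in> \<Omega> \<Longrightarrow> 0 < \<phi> x" "visc_supersolution \<Omega> \<nu> \<phi>" by blast
    then show "\<nu> \<le> max 0 B"
      using B[of \<phi> \<nu>] visc_supersolution_iff_supersols[of \<nu> \<phi>] by (cases "0 \<le> \<nu>") auto
  qed
qed

text \<open>Where \<open>torsion\<close> is at most \<open>B\<close>, the right-hand side 1
  dominates \<open>torsion / B\<close>, which makes \<open>torsion\<close> admissible for the
  parameter 1/B.\<close>

lemma mu1_plus_pos: "0 < mu1_plus \<Omega>"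
proof -
  obtain B where B: "0 < B" "\<And>x. x \<in> \<Omega> \<Longrightarrow> torsion x \<le> B" using torsion_bound by blast
  have "torsion \<in> supersols \<Omega> (1 / B) 0"
    by (rule supersols_change[OF torsion_mem]) (use B in \<open>simp add: field_simps\<close>)
  then have "1 / B \<le> mu1_plus \<Omega>" by (rule le_mu1_plus[OF _ torsion_pos])
  then show ?thesis using B(1) by (smt (verit) zero_less_divide_1_iff)
qed

lemma less_mu1_plusE:
  assumes "0 \<le> \<mu>" "\<mu> < mu1_plus \<Omega>"
  obtains \<nu> \<phi> where "\<mu> < \<nu>" "\<phi> \<in> supersols \<Omega> \<nu> 0" "\<And>x. x \<in> \<Omega> \<Longrightarrow> 0 < \<phi> x"
proof -
  let ?S = "{\<mu>. \<exists>\<phi>. (\<forall>x\<in>\<Omega>. 0 < \<phi> x) \<and> visc_supersolution \<Omega> \<mu> \<phi>}"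
  have "torsion \<in> supersols \<Omega> 0 0" by (rule supersols_change[OF torsion_mem]) simp
  then have "0 \<in> ?S" using torsion_pos supersols_imp_visc_supersolution[OF _ open_dom] by blast
  then obtain \<nu> where "\<nu> \<in> ?S" "\<mu> < \<nu>"
    using less_cSupE[of \<mu> ?S] assms(2) unfolding mu1_plus_def by blast
  then obtain \<phi> where "\<And>x. x \<in> \<Omega> \<Longrightarrow> 0 < \<phi> x" "visc_supersolution \<Omega> \<nu> \<phi>" by blast
  moreover have "0 \<le> \<nu>" using \<open>\<mu> < \<nu>\<close> assms(1) by simp
  ultimately show thesis
    using \<open>\<mu> < \<nu>\<close> visc_supersolution_iff_supersols by (intro that[of \<nu> \<phi>]) blast+
qed

text \<open>Near the boundary the torsion function supplies the right-hand side, since it is small there;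
  away from the boundary a large multiple of \<open>\<phi>\<close> does, since \<open>\<mu> < \<nu>\<close>.\<close>

lemma supersols_nonempty:
  assumes "0 \<le> \<mu>" "\<mu> < mu1_plus \<Omega>"
  shows "supersols \<Omega> \<mu> 1 \<noteq> {}"
proof -
  obtain \<nu> \<phi> where \<nu>: "\<mu> < \<nu>" and \<phi>: "\<phi> \<in> supersols \<Omega> \<nu> 0" and pos: "\<And>x. x \<in> \<Omega> \<Longrightarrow> 0 < \<phi> x"
    using less_mu1_plusE[OF assms] by blast
  obtain B where B: "0 < B" "\<And>x. x \<in> \<Omega> \<Longrightarrow> torsion x \<le> B" using torsion_bound by blast
  define w where "w x = (if x \<in> \<Omega> then torsion x else 0)" for x
  have cont_w: "continuous_on (closure \<Omega>) w"
    unfolding w_def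
    using continuous_on_closure_zero_extension[OF open_dom supersolsD(1)[OF torsion_mem] torsion_boundary] .
  \<comment> \<open>Where \<open>torsion\<close> is too large to pay for itself. As its extension
    vanishes on the boundary, this set is compact inside the domain and \<open>\<phi>\<close> has a
    positive lower bound on it.\<close>
  define C where "C = {x \<in> closure \<Omega>. 1 \<le> 2 * \<mu> * w x}"
  have "C \<subseteq> \<Omega>" by (auto simp: C_def w_def split: if_splits)
  have "closed C" unfolding C_def
    by (intro continuous_on_closed_Collect_le continuous_intros cont_w closed_closure)
  then have "compact C" using bounded_subset[OF bounded_dom \<open>C \<subseteq> \<Omega>\<close>] compact_eq_bounded_closed by blast
  obtain \<kappa> where \<kappa>: "0 < \<kappa>" "\<And>x. x \<in> C \<Longrightarrow> \<kappa> \<le> \<phi> x"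
  proof (cases "C = {}")
    case False
    obtain y where "y \<in> C" "\<And>x. x \<in> C \<Longrightarrow> \<phi> y \<le> \<phi> x"
      using continuous_attains_inf[OF \<open>compact C\<close> False continuous_on_subset[OF supersolsD(1)[OF \<phi>] \<open>C \<subseteq> \<Omega>\<close>]]
      by blast
    then show thesis using that[of "\<phi> y"] pos \<open>C \<subseteq> \<Omega>\<close> by blast
  qed (use that[of 1] in simp)
  define A where "A = (2 * \<mu> * B + 1) / ((\<nu> - \<mu>) * \<kappa>)"
  have "A > 0" using \<nu> \<kappa>(1) B(1) assms(1) by (simp add: A_def add_nonneg_pos)
  \<comment> \<open>Of the two units that \<open>2 * torsion\<close> contributes, one is the
    required right-hand side. The other absorbs \<open>2 * \<mu> * torsion\<close> off
    \<open>C\<close>; on \<open>C\<close> the surplus \<open>A * (\<nu> - \<mu>) * \<phi>\<close>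
    does so, by the choice of \<open>A\<close>.\<close>
  have "(\<lambda>x. A * \<phi> x + 2 * torsion x) \<in> supersols \<Omega> \<mu> 1"
  proof (rule supersolsI)
    show "continuous_on \<Omega> (\<lambda>x. A * \<phi> x + 2 * torsion x)"
      by (intro continuous_intros supersolsD(1)[OF \<phi>] supersolsD(1)[OF torsion_mem])
    fix x assume x: "x \<in> \<Omega>"
    show "0 \<le> A * \<phi> x + 2 * torsion x" using pos[OF x] torsion_pos[OF x] \<open>A > 0\<close> by simp
    have "second_diff_le (\<lambda>x. A * \<phi> x + 2 * torsion x) x (A * (- (\<nu> * \<phi> x + 0)) + 2 * (- (0 * torsion x + 1)))"
      by (intro second_diff_le_add second_diff_le_cmult supersolsD(3)[OF \<phi> x] supersolsD(3)[OF torsion_mem x] \<open>A > 0\<close>) simp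
    moreover have "2 * \<mu> * torsion x \<le> A * (\<nu> - \<mu>) * \<phi> x + 1"
    proof (cases "x \<in> C")
      case True
      have "2 * \<mu> * torsion x \<le> 2 * \<mu> * B" using B(2)[OF x] assms(1) by (intro mult_left_mono) auto
      also have "\<dots> \<le> A * (\<nu> - \<mu>) * \<kappa>" using \<nu> \<kappa>(1) by (simp add: A_def)
      also have "\<dots> \<le> A * (\<nu> - \<mu>) * \<phi> x" using \<kappa>(2)[OF True] \<open>A > 0\<close> \<nu> by (intro mult_left_mono) auto
      finally show ?thesis by simp
    next
      case False
      then have "2 * \<mu> * torsion x < 1" using x closure_subset by (auto simp: C_def w_def)
      moreover have "0 \<le> A * (\<nu> - \<mu>) * \<phi> x" using \<open>A > 0\<close> \<nu> pos[OF x] by simp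
      ultimately show ?thesis by linarith
    qed
    then have "A * (- (\<nu> * \<phi> x + 0)) + 2 * (- (0 * torsion x + 1)) \<le> - (\<mu> * (A * \<phi> x + 2 * torsion x) + 1)"
      by (simp add: algebra_simps)
    ultimately show "second_diff_le (\<lambda>x. A * \<phi> x + 2 * torsion x) x (- (\<mu> * (A * \<phi> x + 2 * torsion x) + 1))"
      by (rule second_diff_le_mono)
  qed
  then show ?thesis by blast
qed

end

section \<open>Passage to the limit\<close>

text \<open>On a compact segment the strict bound on \<open>m\<close> leaves a positive gap. Once
  the right-hand sides are uniformly closer than this gap, the same \<open>m\<close> is admissible
  for \<open>v n\<close>.\<close>

lemma chord_ineq_limit:
  fixes \<Omega> :: "'a::euclidean_space set" and v :: "nat \<Rightarrow> 'a \<Rightarrow> real"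
  assumes ch: "\<And>n. chord_ineq \<Omega> (\<mu> n) (g n) (v n)"
    and lim: "\<And>x. x \<in> \<Omega> \<Longrightarrow> (\<lambda>n. v n x) \<longlonglongrightarrow> \<psi> x"
    and unif: "\<And>e. 0 < e \<Longrightarrow> \<forall>\<^sub>F n in sequentially. \<forall>x\<in>\<Omega>. \<bar>\<mu> n * v n x + g n - (\<nu> * \<psi> x + \<gamma>)\<bar> < e"
    and cont: "continuous_on \<Omega> \<psi>"
  shows "chord_ineq \<Omega> \<nu> \<gamma> \<psi>"
proof (rule chord_ineq_weakenI)
  fix a b m and t :: real
  assume seg: "closed_segment a b \<subseteq> \<Omega>" and m: "\<And>y. y \<in> closed_segment a b \<Longrightarrow> m < \<nu> * \<psi> y + \<gamma>"
    and t: "0 \<le> t" "t \<le> 1"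
  have "continuous_on (closed_segment a b) (\<lambda>y. \<nu> * \<psi> y + \<gamma>)"
    by (intro continuous_intros continuous_on_subset[OF cont seg])
  then obtain y0 where y0: "y0 \<in> closed_segment a b"
    "\<And>y. y \<in> closed_segment a b \<Longrightarrow> \<nu> * \<psi> y0 + \<gamma> \<le> \<nu> * \<psi> y + \<gamma>"
    using continuous_attains_inf[OF compact_segment, of a b] by (metis ends_in_segment(1) empty_iff)
  have "0 < \<nu> * \<psi> y0 + \<gamma> - m" using m[OF y0(1)] by simp
  from unif[OF this] have ev: "\<forall>\<^sub>F n in sequentially.
      (1 - t) * v n a + t * v n b + m / 2 * (t * (1 - t)) * (norm (b - a))\<^sup>2
        \<le> v n ((1 - t) *\<^sub>R a + t *\<^sub>R b)"
  proof eventually_elim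
    case (elim n)
    have "m \<le> \<mu> n * v n y + g n" if "y \<in> closed_segment a b" for y
    proof -
      have "\<bar>\<mu> n * v n y + g n - (\<nu> * \<psi> y + \<gamma>)\<bar> < \<nu> * \<psi> y0 + \<gamma> - m"
        using elim that seg by blast
      then show ?thesis using y0(2)[OF that] by linarith
    qed
    then show ?case by (rule chord_ineqD[OF ch seg _ t])
  qed
  have "a \<in> \<Omega>" "b \<in> \<Omega>" using seg by auto
  moreover have "(1 - t) *\<^sub>R a + t *\<^sub>R b \<in> \<Omega>"
    using seg t unfolding closed_segment_def by blast
  ultimately have "(\<lambda>n. v n a) \<longlonglongrightarrow> \<psi> a" "(\<lambda>n. v n b) \<longlonglongrightarrow> \<psi> b"
    "(\<lambda>n. v n ((1 - t) *\<^sub>R a + t *\<^sub>R b)) \<longlonglongrightarrow> \<psi> ((1 - t) *\<^sub>R a + t *\<^sub>R b)"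
    by (auto intro: lim)
  then show "(1 - t) * \<psi> a + t * \<psi> b + m / 2 * (t * (1 - t)) * (norm (b - a))\<^sup>2
        \<le> \<psi> ((1 - t) *\<^sub>R a + t *\<^sub>R b)"
    by (intro tendsto_le[OF trivial_limit_sequentially _ _ ev] tendsto_intros)
qed

context strictly_convex_domain begin

section \<open>Compactness of the normalized least supersolutions\<close>

lemma least_le_torsion:
  assumes v: "v \<in> supersols \<Omega> \<mu> g" and least: "\<And>w y. w \<in> supersols \<Omega> \<mu> g \<Longrightarrow> y \<in> \<Omega> \<Longrightarrow> v y \<le> w y"
    and "0 \<le> \<mu>" "g \<le> 1" and le1: "\<And>y. y \<in> \<Omega> \<Longrightarrow> v y \<le> 1" and x: "x \<in> \<Omega>"
  shows "v x \<le> (\<mu> + 1) * torsion x"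
proof -
  \<comment> \<open>Since v and g are at most 1, the demanded \<open>\<mu> * ?w y + g\<close> never
    exceeds \<open>\<mu> + 1\<close>, which is what this multiple of \<open>torsion\<close>
    supplies. The minimum is thus a competitor, and minimality of v gives the bound.\<close>
  let ?w = "\<lambda>y. min (v y) ((\<mu> + 1) * torsion y)"
  have "?w \<in> supersols \<Omega> \<mu> g"
  proof (rule supersolsI)
    show "continuous_on \<Omega> ?w"
      by (intro continuous_intros supersolsD(1)[OF v] supersolsD(1)[OF torsion_mem])
    fix y assume y: "y \<in> \<Omega>"
    show "0 \<le> ?w y" using supersolsD(2)[OF v y] torsion_pos[OF y] \<open>0 \<le> \<mu>\<close> by simp
    show "second_diff_le ?w y (- (\<mu> * ?w y + g))"
    proof (rule second_diff_le_min)
      assume "v y \<le> (\<mu> + 1) * torsion y"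
      then show "second_diff_le v y (- (\<mu> * ?w y + g))" using supersolsD(3)[OF v y] by simp
    next
      have "second_diff_le (\<lambda>y. (\<mu> + 1) * torsion y) y ((\<mu> + 1) * (- (0 * torsion y + 1)))"
        using \<open>0 \<le> \<mu>\<close> by (intro second_diff_le_cmult supersolsD(3)[OF torsion_mem y]) simp
      moreover have "\<mu> * ?w y \<le> \<mu> * 1" using le1[OF y] \<open>0 \<le> \<mu>\<close> by (intro mult_left_mono) auto
      then have "(\<mu> + 1) * (- (0 * torsion y + 1)) \<le> - (\<mu> * ?w y + g)" using \<open>g \<le> 1\<close> by simp
      ultimately show "second_diff_le (\<lambda>y. (\<mu> + 1) * torsion y) y (- (\<mu> * ?w y + g))"
        by (rule second_diff_le_mono)
    qed
  qed
  then show ?thesis using least[of ?w x] x by simp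
qed

text \<open>The least solution \<open>u\<close> with right-hand side \<open>- 1\<close>, divided by \<open>1 + sup u\<close>: it stays bounded
  by 1, and \<open>1 - g\<close> is exactly its supremum.\<close>

lemma normalized_least_supersol:
  assumes "0 \<le> \<mu>" "\<mu> < mu1_plus \<Omega>"
  shows "\<exists>g v. 0 < g \<and> g \<le> 1 \<and> v \<in> supersols \<Omega> \<mu> g \<and>
    (\<forall>w\<in>supersols \<Omega> \<mu> g. \<forall>x\<in>\<Omega>. v x \<le> w x) \<and> (\<forall>x\<in>\<Omega>. v x \<le> 1) \<and>
    (\<forall>c. (\<forall>x\<in>\<Omega>. v x \<le> c) \<longrightarrow> 1 - g \<le> c)"
proof -
  define u where "u = least_supersol \<Omega> \<mu> 1"
  have u: "u \<in> supersols \<Omega> \<mu> 1"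
    unfolding u_def
    by (rule least_supersol_mem[OF supersols_nonempty[OF assms] open_dom convex_dom assms(1)]) simp
  define s where "s = (SUP x\<in>\<Omega>. u x)"
  have bdd: "bdd_above (u ` \<Omega>)" using supersols_bdd_above[OF u assms(1)] by simp
  have le_s: "u x \<le> s" if "x \<in> \<Omega>" for x unfolding s_def by (rule cSUP_upper[OF that bdd])
  have "0 \<le> s" using nonempty_dom le_s supersolsD(2)[OF u] order_trans by blast
  define g where "g = 1 / (1 + s)"
  have g: "0 < g" "g \<le> 1" "g * (1 + s) = 1" using \<open>0 \<le> s\<close> by (auto simp: g_def)
  have v: "(\<lambda>x. g * u x) \<in> supersols \<Omega> \<mu> g" using supersols_cmult[OF u g(1)] by simp
  \<comment> \<open>Scaling by 1 + s carries competitors for g to competitors for 1, where u is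
    least.\<close>
  have least: "g * u x \<le> w x" if w: "w \<in> supersols \<Omega> \<mu> g" and x: "x \<in> \<Omega>" for w x
  proof -
    have "(\<lambda>x. (1 + s) * w x) \<in> supersols \<Omega> \<mu> ((1 + s) * g)"
      using \<open>0 \<le> s\<close> by (intro supersols_cmult[OF w]) simp
    then have "(\<lambda>x. (1 + s) * w x) \<in> supersols \<Omega> \<mu> 1" using g(3) by (simp add: mult.commute)
    then have "u x \<le> (1 + s) * w x" unfolding u_def by (rule least_supersol_le[OF _ x])
    then have "g * u x \<le> g * ((1 + s) * w x)" using g(1) by simp
    also have "\<dots> = w x" using g(3) by (simp flip: mult.assoc)
    finally show ?thesis .
  qed
  have le: "g * u x \<le> 1" if "x \<in> \<Omega>" for x
  proof -
    have "g * u x \<le> g * (1 + s)" using le_s[OF that] g(1) by (intro mult_left_mono) auto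
    then show ?thesis using g(3) by simp
  qed
  have "1 - g \<le> c" if c: "\<And>x. x \<in> \<Omega> \<Longrightarrow> g * u x \<le> c" for c
  proof -
    have "s \<le> c / g" unfolding s_def
      by (rule cSUP_least[OF nonempty_dom]) (use c g(1) in \<open>simp add: field_simps\<close>)
    then have "g * s \<le> c" using g(1) by (simp add: field_simps)
    then show ?thesis using g(3) by (simp add: algebra_simps)
  qed
  then show ?thesis
    using g v least le by (intro exI[of _ g] exI[of _ "\<lambda>x. g * u x"]) auto
qed

text \<open>Equicontinuity is uniform in n for two reasons: inside, the Lipschitz bound for concave
  functions with values in [0,1]; at the boundary, the common barrier
  \<open>(M + 1) * torsion\<close>.\<close>

lemma convergent_normalized_sequence:
  obtains \<mu> g :: "nat \<Rightarrow> real" and v :: "nat \<Rightarrow> real^'n \<Rightarrow> real" and \<psi> :: "real^'n \<Rightarrow> real" and \<gamma> :: real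
  where "\<forall>n. 0 \<le> \<mu> n" "\<forall>n. v n \<in> supersols \<Omega> (\<mu> n) (g n)"
    "\<forall>n. \<forall>w\<in>supersols \<Omega> (\<mu> n) (g n). \<forall>x\<in>\<Omega>. v n x \<le> w x"
    "\<forall>n. \<forall>x\<in>\<Omega>. v n x \<le> 1" "\<forall>n c. (\<forall>x\<in>\<Omega>. v n x \<le> c) \<longrightarrow> 1 - g n \<le> c"
    "\<mu> \<longlonglongrightarrow> mu1_plus \<Omega>" "g \<longlonglongrightarrow> \<gamma>" "0 \<le> \<gamma>"
    "continuous_on (closure \<Omega>) \<psi>" "\<forall>x\<in>frontier \<Omega>. \<psi> x = 0"
    "\<forall>e>0. \<forall>\<^sub>F n in sequentially. \<forall>x\<in>\<Omega>. \<bar>v n x - \<psi> x\<bar> < e"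
proof -
  define M where "M = mu1_plus \<Omega>"
  have "0 < M" unfolding M_def by (rule mu1_plus_pos)
  define \<mu> where "\<mu> n = M - M / real (Suc n)" for n
  have \<mu>: "0 \<le> \<mu> n" "\<mu> n < M" for n using \<open>0 < M\<close> by (auto simp: \<mu>_def field_simps)
  have "(\<lambda>n. M - M * (1 / real (Suc n))) \<longlonglongrightarrow> M - M * 0"
    by (intro tendsto_intros LIMSEQ_Suc[OF lim_1_over_n])
  then have \<mu>_lim: "\<mu> \<longlonglongrightarrow> M" unfolding \<mu>_def by simp
  have "\<forall>n. \<exists>g v. 0 < g \<and> g \<le> 1 \<and> v \<in> supersols \<Omega> (\<mu> n) g \<and>
    (\<forall>w\<in>supersols \<Omega> (\<mu> n) g. \<forall>x\<in>\<Omega>. v x \<le> w x) \<and> (\<forall>x\<in>\<Omega>. v x \<le> 1) \<and>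
    (\<forall>c. (\<forall>x\<in>\<Omega>. v x \<le> c) \<longrightarrow> 1 - g \<le> c)"
    using normalized_least_supersol \<mu> unfolding M_def by blast
  then obtain g v where gv: "\<forall>n. 0 < g n \<and> g n \<le> 1 \<and> v n \<in> supersols \<Omega> (\<mu> n) (g n) \<and>
    (\<forall>w\<in>supersols \<Omega> (\<mu> n) (g n). \<forall>x\<in>\<Omega>. v n x \<le> w x) \<and> (\<forall>x\<in>\<Omega>. v n x \<le> 1) \<and>
    (\<forall>c. (\<forall>x\<in>\<Omega>. v n x \<le> c) \<longrightarrow> 1 - g n \<le> c)"
    by metis
  have g: "0 \<le> g n" "g n \<le> 1" and v: "v n \<in> supersols \<Omega> (\<mu> n) (g n)"
    and least: "w \<in> supersols \<Omega> (\<mu> n) (g n) \<Longrightarrow> x \<in> \<Omega> \<Longrightarrow> v n x \<le> w x"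
    and le1: "x \<in> \<Omega> \<Longrightarrow> v n x \<le> 1" and sup: "(\<And>x. x \<in> \<Omega> \<Longrightarrow> v n x \<le> c) \<Longrightarrow> 1 - g n \<le> c" for n w x c
    using gv by (auto intro: less_imp_le)
  \<comment> \<open>Extension by zero places the whole sequence on the compact closure, so that the
    limit is continuous up to the boundary and vanishes there.\<close>
  define z where "z n x = (if x \<in> \<Omega> then v n x else 0)" for n x
  have barrier: "\<bar>v n x\<bar> \<le> (M + 1) * torsion x" if x: "x \<in> \<Omega>" for n x
  proof -
    have "v n x \<le> (\<mu> n + 1) * torsion x"
      by (rule least_le_torsion[of "v n" "\<mu> n" "g n"]) (auto intro: v least \<mu>(1) g(2) le1 x)
    also have "\<dots> \<le> (M + 1) * torsion x"
      using \<mu>(2)[of n] torsion_pos[OF x] by (intro mult_right_mono) auto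
    finally show ?thesis using supersolsD(2)[OF v x] by simp
  qed
  have equicont: "\<exists>d>0. \<forall>n y. y \<in> closure \<Omega> \<and> norm (x - y) < d \<longrightarrow> norm (z n x - z n y) < e"
    if x: "x \<in> closure \<Omega>" and e: "0 < e" for x e
  proof (cases "x \<in> \<Omega>")
    case True
    obtain R where R: "R > 0" "cball x R \<subseteq> \<Omega>" using True open_dom open_contains_cball by blast
    show ?thesis
    proof (intro exI conjI allI impI)
      show "0 < min R (e * R)" using R e by simp
      fix n y assume "y \<in> closure \<Omega> \<and> norm (x - y) < min R (e * R)"
      then have y: "dist x y < R" "dist x y / R < e" using R(1) by (auto simp: dist_norm field_simps)
      then have "y \<in> \<Omega>" using R(2) by auto
      have "\<bar>v n x - v n y\<bar> \<le> dist x y / R"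
        by (rule concave_local_Lipschitz[OF supersols_concave[OF v \<mu>(1) g(1)] supersolsD(2)[OF v] le1 R y(1)])
      then show "norm (z n x - z n y) < e" using y(2) True \<open>y \<in> \<Omega>\<close> by (simp add: z_def)
    qed
  next
    case False
    then have "x \<in> frontier \<Omega>" using x open_dom by (simp add: frontier_def interior_open)
    moreover have "0 < e / (M + 1)" using e \<open>0 < M\<close> by simp
    ultimately obtain d where d: "d > 0" "\<And>y. y \<in> \<Omega> \<Longrightarrow> dist y x < d \<Longrightarrow> \<bar>torsion y\<bar> < e / (M + 1)"
      using torsion_boundary by meson
    show ?thesis
    proof (intro exI conjI allI impI)
      fix n y assume y: "y \<in> closure \<Omega> \<and> norm (x - y) < d"
      show "norm (z n x - z n y) < e"
      proof (cases "y \<in> \<Omega>")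
        case True
        have "dist y x < d" using y by (simp add: dist_norm norm_minus_commute)
        then have "torsion y < e / (M + 1)" using d(2)[OF True] by simp
        then have "(M + 1) * torsion y < e" using \<open>0 < M\<close> by (simp add: field_simps)
        then show ?thesis using barrier[OF True, of n] False True by (simp add: z_def)
      qed (use e False in \<open>simp add: z_def\<close>)
    qed (rule d(1))
  qed
  have "\<forall>n. g n \<in> {0..1}" using g by simp
  \<comment> \<open>Two extractions: \<open>r\<close> makes the right-hand sides converge, then
    \<open>k\<close> the functions; \<open>R\<close> is their composition.\<close>
  then obtain \<gamma> r where r: "\<gamma> \<in> {0..1}" "strict_mono r" "(g \<circ> r) \<longlonglongrightarrow> \<gamma>"
    using compact_Icc[of "0::real" 1] unfolding compact_def by meson
  obtain \<psi> k where \<psi>: "continuous_on (closure \<Omega>) \<psi>" and k: "strict_mono (k :: nat \<Rightarrow> nat)"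
    and conv: "\<And>e. 0 < e \<Longrightarrow> \<exists>N. \<forall>n x. n \<ge> N \<and> x \<in> closure \<Omega> \<longrightarrow> norm (z (r (k n)) x - \<psi> x) < e"
  proof (rule Arzela_Ascoli[of "closure \<Omega>" "\<lambda>n. z (r n)" 1])
    show "compact (closure \<Omega>)" using bounded_dom by simp
    show "norm (z (r n) x) \<le> 1" for n x
      using le1 supersolsD(2)[OF v] by (simp add: z_def)
    show "\<exists>d>0. \<forall>n y. y \<in> closure \<Omega> \<and> norm (x - y) < d \<longrightarrow> norm (z (r n) x - z (r n) y) < e"
      if "x \<in> closure \<Omega>" "0 < e" for x e
      using equicont[OF that] by blast
  qed (rule that; assumption)
  define R where "R = r \<circ> k"
  have R: "strict_mono R" unfolding R_def by (rule strict_mono_o[OF r(2) k])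
  have conv': "\<forall>\<^sub>F n in sequentially. \<forall>x\<in>closure \<Omega>. \<bar>z (R n) x - \<psi> x\<bar> < e" if "0 < e" for e
    using conv[OF that] unfolding eventually_sequentially R_def by auto
  show thesis
  proof (rule that[of "\<mu> \<circ> R" "v \<circ> R" "g \<circ> R" \<gamma> \<psi>])
    show "(\<mu> \<circ> R) \<longlonglongrightarrow> mu1_plus \<Omega>"
      using LIMSEQ_subseq_LIMSEQ[OF \<mu>_lim R] by (simp add: M_def)
    show "(g \<circ> R) \<longlonglongrightarrow> \<gamma>"
      using LIMSEQ_subseq_LIMSEQ[OF r(3) k] by (simp add: R_def comp_assoc)
    show "\<forall>x\<in>frontier \<Omega>. \<psi> x = 0"
    proof
      fix x assume x: "x \<in> frontier \<Omega>"
      have x': "x \<in> closure \<Omega>" "x \<notin> \<Omega>" using x open_dom by (auto simp: frontier_def interior_open)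
      have "\<bar>\<psi> x\<bar> < e" if e: "0 < e" for e
      proof -
        obtain n where "\<forall>x\<in>closure \<Omega>. \<bar>z (R n) x - \<psi> x\<bar> < e"
          using eventually_happens[OF conv'[OF e]] by auto
        then show ?thesis using x' by (auto simp: z_def)
      qed
      then show "\<psi> x = 0" by (metis less_irrefl zero_less_abs_iff)
    qed
    show "\<forall>e>0. \<forall>\<^sub>F n in sequentially. \<forall>x\<in>\<Omega>. \<bar>(v \<circ> R) n x - \<psi> x\<bar> < e"
    proof (intro allI impI)
      fix e :: real assume "0 < e"
      from conv'[OF this] show "\<forall>\<^sub>F n in sequentially. \<forall>x\<in>\<Omega>. \<bar>(v \<circ> R) n x - \<psi> x\<bar> < e"
      proof eventually_elim
        case (elim n)
        show ?case
        proof
          fix x assume "x \<in> \<Omega>"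
          then show "\<bar>(v \<circ> R) n x - \<psi> x\<bar> < e"
            using elim[rule_format, of x] closure_subset[of \<Omega>] by (auto simp: z_def)
        qed
      qed
    qed
  qed (use \<mu> g v least le1 sup r(1) \<psi> in auto)
qed

section \<open>The limit is a positive eigenfunction\<close>

theorem eigenfunction_exists:
  "\<exists>\<psi>. continuous_on (closure \<Omega>) \<psi> \<and> visc_solution \<Omega> (mu1_plus \<Omega>) \<psi> \<and>
     (\<forall>x\<in>\<Omega>. 0 < \<psi> x) \<and> (\<forall>x\<in>frontier \<Omega>. \<psi> x = 0)"
proof -
  define M where "M = mu1_plus \<Omega>"
  have "0 < M" unfolding M_def by (rule mu1_plus_pos)
  obtain \<mu> g v \<psi> \<gamma> where seq: "\<forall>n. 0 \<le> \<mu> n" "\<forall>n. v n \<in> supersols \<Omega> (\<mu> n) (g n)"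
      "\<forall>n. \<forall>w\<in>supersols \<Omega> (\<mu> n) (g n). \<forall>x\<in>\<Omega>. v n x \<le> w x"
      "\<forall>n. \<forall>x\<in>\<Omega>. v n x \<le> 1" "\<forall>n c. (\<forall>x\<in>\<Omega>. v n x \<le> c) \<longrightarrow> 1 - g n \<le> c"
    and \<mu>_lim: "\<mu> \<longlonglongrightarrow> M" and g_lim: "g \<longlonglongrightarrow> \<gamma>" and "0 \<le> \<gamma>"
    and \<psi>_cont: "continuous_on (closure \<Omega>) \<psi>" and \<psi>_bd: "\<forall>x\<in>frontier \<Omega>. \<psi> x = 0"
    and unif': "\<forall>e>0. \<forall>\<^sub>F n in sequentially. \<forall>x\<in>\<Omega>. \<bar>v n x - \<psi> x\<bar> < e"
    unfolding M_def by (rule convergent_normalized_sequence)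
  have \<mu>: "0 \<le> \<mu> n" and v: "v n \<in> supersols \<Omega> (\<mu> n) (g n)"
    and least: "w \<in> supersols \<Omega> (\<mu> n) (g n) \<Longrightarrow> x \<in> \<Omega> \<Longrightarrow> v n x \<le> w x"
    and le1: "x \<in> \<Omega> \<Longrightarrow> v n x \<le> 1" and sup: "(\<And>x. x \<in> \<Omega> \<Longrightarrow> v n x \<le> c) \<Longrightarrow> 1 - g n \<le> c"
    and unif: "0 < e \<Longrightarrow> \<forall>\<^sub>F n in sequentially. \<forall>x\<in>\<Omega>. \<bar>v n x - \<psi> x\<bar> < e" for n w x c e
    using seq unif' by auto
  have cont: "continuous_on \<Omega> \<psi>" using \<psi>_cont closure_subset by (rule continuous_on_subset)
  have lim: "(\<lambda>n. v n x) \<longlonglongrightarrow> \<psi> x" if "x \<in> \<Omega>" for x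
    unfolding tendsto_iff dist_real_def
    by (intro allI impI eventually_mono[OF unif]) (use that in auto)
  have \<psi>_nonneg: "0 \<le> \<psi> x" if "x \<in> \<Omega>" for x
    using lim[OF that] supersolsD(2)[OF v that] by (intro LIMSEQ_le_const) auto
  have \<psi>_le1: "\<psi> x \<le> 1" if "x \<in> \<Omega>" for x
    using lim[OF that] le1[OF that] by (intro LIMSEQ_le_const2) auto
  have unif_rhs: "\<forall>\<^sub>F n in sequentially. \<forall>x\<in>\<Omega>. \<bar>\<mu> n * v n x + g n - (M * \<psi> x + \<gamma>)\<bar> < e" if "0 < e" for e
  proof -
    have "0 < e / 3" "0 < e / 3 / M" using that \<open>0 < M\<close> by auto
    from unif[OF this(2)] tendstoD[OF \<mu>_lim this(1)] tendstoD[OF g_lim this(1)] show ?thesis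
    proof eventually_elim
      case (elim n)
      show ?case
      proof
        fix x assume x: "x \<in> \<Omega>"
        have "\<mu> n * v n x + g n - (M * \<psi> x + \<gamma>) = (\<mu> n - M) * v n x + M * (v n x - \<psi> x) + (g n - \<gamma>)"
          by (simp add: algebra_simps)
        moreover have "\<bar>(\<mu> n - M) * v n x\<bar> \<le> \<bar>\<mu> n - M\<bar>"
          using le1[OF x] supersolsD(2)[OF v x] by (simp add: abs_mult mult_left_le)
        moreover have "\<bar>M * (v n x - \<psi> x)\<bar> < e / 3"
          using elim(1)[rule_format, OF x] \<open>0 < M\<close> by (simp add: abs_mult pos_less_divide_eq mult.commute)
        ultimately show "\<bar>\<mu> n * v n x + g n - (M * \<psi> x + \<gamma>)\<bar> < e"
          using elim(2,3) unfolding dist_real_def by linarith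
      qed
    qed
  qed
  have "chord_ineq \<Omega> M \<gamma> \<psi>"
    by (rule chord_ineq_limit[OF supersols_chord_ineq[OF v] lim unif_rhs cont])
  then have \<psi>: "\<psi> \<in> supersols \<Omega> M \<gamma>"
    using \<open>0 < M\<close> \<open>0 \<le> \<gamma>\<close>
    by (intro chord_ineq_imp_supersols[OF _ open_dom convex_dom \<psi>_nonneg]) auto
  have "\<gamma> = 0"
  proof (rule ccontr)
    assume "\<gamma> \<noteq> 0"
    then have "0 < \<gamma>" using \<open>0 \<le> \<gamma>\<close> by simp
    have pos: "0 < \<psi> x" if "x \<in> \<Omega>" for x
      by (rule supersols_pos[OF \<psi> open_dom _ \<open>0 < \<gamma>\<close> that]) (use \<open>0 < M\<close> in simp)
    \<comment> \<open>Because \<open>\<psi>\<close> is at most 1,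
      \<open>\<gamma> * \<psi> \<le> \<gamma>\<close>.\<close>
    have "\<psi> \<in> supersols \<Omega> (M + \<gamma>) 0"
      by (rule supersols_change[OF \<psi>]) (use \<psi>_le1 \<open>0 < \<gamma>\<close> in \<open>auto simp: algebra_simps mult_left_le_one_le\<close>)
    then have "M + \<gamma> \<le> M" unfolding M_def by (rule le_mu1_plus[OF _ pos])
    then show False using \<open>0 < \<gamma>\<close> by simp
  qed
  \<comment> \<open>The supremum of \<open>v n\<close> is at least \<open>1 - g n\<close>, which
    tends to 1, so uniform convergence excludes a zero limit.\<close>
  have "\<exists>y\<in>\<Omega>. 0 < \<psi> y"
  proof (rule ccontr)
    assume "\<not> ?thesis"
    then have zero: "\<psi> x = 0" if "x \<in> \<Omega>" for x using \<psi>_nonneg[OF that] that by force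
    have "0 < (1/3::real)" by simp
    from unif[OF this] tendstoD[OF g_lim this]
    have "\<forall>\<^sub>F n in sequentially. (\<forall>x\<in>\<Omega>. \<bar>v n x - \<psi> x\<bar> < 1/3) \<and> dist (g n) \<gamma> < 1/3"
      by eventually_elim simp
    then obtain n where n: "\<forall>x\<in>\<Omega>. \<bar>v n x - \<psi> x\<bar> < 1/3" "dist (g n) \<gamma> < 1/3"
      using eventually_happens by fastforce
    have "v n x \<le> 1/3" if "x \<in> \<Omega>" for x using n(1) zero[OF that] that by force
    then have "1 - g n \<le> 1/3" by (rule sup)
    then show False using n(2) \<open>\<gamma> = 0\<close> by (simp add: dist_real_def)
  qed
  then obtain y where y: "y \<in> \<Omega>" "0 < \<psi> y" by blast
  have conc: "concave_on \<Omega> \<psi>" using supersols_concave[OF \<psi>] \<open>0 < M\<close> \<open>0 \<le> \<gamma>\<close> by simp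
  have pos: "0 < \<psi> x" if "x \<in> \<Omega>" for x
    by (rule concave_pos[OF conc \<psi>_nonneg open_dom that y])
  have super: "visc_supersolution \<Omega> M \<psi>"
    using supersols_imp_visc_supersolution[OF _ open_dom] \<psi> \<open>\<gamma> = 0\<close> by blast
  have sub: "visc_subsolution \<Omega> M \<psi>"
    unfolding visc_subsolution_def
  proof (intro conjI ballI allI impI)
    show "usc_on \<Omega> \<psi>" by (rule continuous_on_imp_usc_on[OF cont])
    fix x0 \<phi> assume x0: "x0 \<in> \<Omega>" and C2: "C2_near \<phi> x0"
      and "\<forall>\<^sub>F x in at x0 within \<Omega>. \<psi> x - \<phi> x \<le> \<psi> x0 - \<phi> x0"
    then have touch: "\<forall>\<^sub>F x in nhds x0. \<psi> x - \<phi> x \<le> \<psi> x0 - \<phi> x0"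
      using open_dom by (intro eventually_at_within_open_nhds) auto
    show "0 \<le> P1_plus (hessian \<phi> x0) + M * \<psi> x0"
    proof (rule ccontr)
      define P where "P = P1_plus (hessian \<phi> x0)"
      assume "\<not> 0 \<le> P1_plus (hessian \<phi> x0) + M * \<psi> x0"
      \<comment> \<open>The deficit is split into five parts. Four raise the second derivative of
        the paraboloid to \<open>- a = P + 4 * \<epsilon>\<close>; the resulting
        \<open>2 * \<epsilon>\<close> in front of the squared norm covers the Taylor error and
        leaves a margin \<open>\<epsilon>\<close> above \<open>\<psi>\<close>. The fifth is shared
        by the continuity of \<open>\<psi>\<close> and the convergence of the right-hand
        sides.\<close>
      define \<epsilon> where "\<epsilon> = - (P + M * \<psi> x0) / 5"
      have \<epsilon>: "0 < \<epsilon>" using \<open>\<not> _\<close> by (simp add: \<epsilon>_def P_def)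
      define a where "a = - (P + 4 * \<epsilon>)"
      have a: "a = M * \<psi> x0 + \<epsilon>" by (simp add: a_def \<epsilon>_def field_simps)
      define p where "p = gradient \<phi> x0"
      define q where "q c y = c + p \<bullet> (y - x0) + (- a) / 2 * (norm (y - x0))\<^sup>2" for c y
      obtain r1 where r1: "0 < r1" "\<And>h. norm h < r1 \<Longrightarrow>
          \<bar>\<phi> (x0 + h) - \<phi> x0 - p \<bullet> h - (h \<bullet> (hessian \<phi> x0 *v h)) / 2\<bar> \<le> \<epsilon> * (norm h)\<^sup>2"
        unfolding p_def using second_order_Taylor[OF C2 \<epsilon>] by blast
      have \<psi>_tendsto: "(\<psi> \<longlongrightarrow> \<psi> x0) (nhds x0)"
        using cont x0 open_dom by (simp add: continuous_on_eq_continuous_at continuous_at tendsto_at_iff_tendsto_nhds)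
      have q_tendsto: "(q (\<psi> x0) \<longlongrightarrow> q (\<psi> x0) x0) (nhds x0)"
        unfolding q_def by (intro tendsto_intros filterlim_ident)
      have "\<forall>\<^sub>F y in nhds x0. M * \<psi> y < M * \<psi> x0 + \<epsilon> / 2"
        by (rule order_tendstoD(2)[OF tendsto_mult[OF tendsto_const \<psi>_tendsto]]) (use \<epsilon> in simp)
      moreover have "\<forall>\<^sub>F y in nhds x0. \<psi> x0 / 2 < q (\<psi> x0) y"
        by (rule order_tendstoD(1)[OF q_tendsto]) (use pos[OF x0] in \<open>simp add: q_def\<close>)
      moreover have "\<forall>\<^sub>F y in nhds x0. y \<in> \<Omega>" using open_dom x0 by (rule eventually_nhds_in_open)
      ultimately have "\<forall>\<^sub>F y in nhds x0. \<psi> y - \<phi> y \<le> \<psi> x0 - \<phi> x0 \<and> M * \<psi> y < M * \<psi> x0 + \<epsilon> / 2 \<and>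
          \<psi> x0 / 2 < q (\<psi> x0) y \<and> y \<in> \<Omega>"
        using touch by eventually_elim simp
      then obtain r2 where r2: "0 < r2" "\<And>y. dist y x0 < r2 \<Longrightarrow> \<psi> y - \<phi> y \<le> \<psi> x0 - \<phi> x0 \<and>
          M * \<psi> y < M * \<psi> x0 + \<epsilon> / 2 \<and> \<psi> x0 / 2 < q (\<psi> x0) y \<and> y \<in> \<Omega>"
        unfolding eventually_nhds_metric by blast
      define r where "r = min r1 r2"
      have r: "0 < r" "r \<le> r1" "r \<le> r2" using r1(1) r2(1) by (auto simp: r_def)
      have in_dom: "y \<in> \<Omega>" if "dist y x0 < r" for y using r2(2) that r by auto
      have q_above: "\<psi> y + \<epsilon> * (norm (y - x0))\<^sup>2 \<le> q (\<psi> x0) y" if "dist y x0 < r" for y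
      proof -
        have "norm (y - x0) < r1" using that r by (simp add: dist_norm)
        then have "\<phi> y - \<phi> x0 \<le> p \<bullet> (y - x0) + ((y - x0) \<bullet> (hessian \<phi> x0 *v (y - x0))) / 2 + \<epsilon> * (norm (y - x0))\<^sup>2"
          using r1(2)[of "y - x0"] by simp
        moreover have "(y - x0) \<bullet> (hessian \<phi> x0 *v (y - x0)) \<le> P * (norm (y - x0))\<^sup>2"
          unfolding P_def by (rule inner_le_P1_plus[OF hessian_symmetric[OF C2]])
        moreover have "\<psi> y \<le> \<psi> x0 + (\<phi> y - \<phi> x0)" using r2(2)[of y] that r by simp
        ultimately show ?thesis unfolding q_def a_def by (simp add: algebra_simps add_divide_distrib diff_divide_distrib)
      qed
      \<comment> \<open>The first bound keeps the lowered paraboloid above \<open>v n\<close> beyond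
        radius r/2, as \<open>v n\<close> is within \<open>\<delta>\<close> of
        \<open>\<psi>\<close>; the second keeps it nonnegative.\<close>
      define \<delta> where "\<delta> = min (\<epsilon> * (r / 2)\<^sup>2 / 2) (\<psi> x0 / 2)"
      have \<delta>: "0 < \<delta>" "2 * \<delta> \<le> \<epsilon> * (r / 2)\<^sup>2" "\<delta> \<le> \<psi> x0 / 2"
        using \<epsilon> r(1) pos[OF x0] by (auto simp: \<delta>_def)
      have "0 < \<epsilon> / 2" using \<epsilon> by simp
      from unif[OF \<delta>(1)] unif_rhs[OF this]
      have "\<forall>\<^sub>F n in sequentially. (\<forall>x\<in>\<Omega>. \<bar>v n x - \<psi> x\<bar> < \<delta>) \<and>
          (\<forall>x\<in>\<Omega>. \<bar>\<mu> n * v n x + g n - (M * \<psi> x + \<gamma>)\<bar> < \<epsilon> / 2)"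
        by eventually_elim simp
      then obtain n where n: "\<And>x. x \<in> \<Omega> \<Longrightarrow> \<bar>v n x - \<psi> x\<bar> < \<delta>"
          "\<And>x. x \<in> \<Omega> \<Longrightarrow> \<bar>\<mu> n * v n x + g n - (M * \<psi> x + \<gamma>)\<bar> < \<epsilon> / 2"
        using eventually_happens by fastforce
      define c where "c = \<psi> x0 - \<delta>"
      have qc: "q c y = q (\<psi> x0) y - \<delta>" for y by (simp add: q_def c_def)
      define w where "w y = (if dist y x0 < r then min (v n y) (q c y) else v n y)" for y
      have w_le: "w y \<le> v n y" for y by (simp add: w_def)
      have w_outer: "w y = v n y" if y: "y \<in> \<Omega>" "r / 2 < dist y x0" for y
      proof (cases "dist y x0 < r")
        case True
        have "(r / 2)\<^sup>2 \<le> (norm (y - x0))\<^sup>2" using y(2) r(1) by (intro power_mono) (auto simp: dist_norm)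
        then have "\<epsilon> * (r / 2)\<^sup>2 \<le> \<epsilon> * (norm (y - x0))\<^sup>2" using \<epsilon> by simp
        then have "v n y \<le> q c y" using q_above[OF True] n(1)[OF y(1)] \<delta>(2) unfolding qc by linarith
        then show ?thesis by (simp add: w_def)
      qed (simp add: w_def)
      have "w \<in> supersols \<Omega> (\<mu> n) (g n)"
      proof (rule supersolsI)
        have ball_dom: "ball x0 r \<subseteq> \<Omega>" using in_dom by (auto simp: dist_commute)
        \<comment> \<open>In the annulus between r/2 and r the function \<open>w\<close> already
          equals \<open>v n\<close>, so two overlapping open sets cover the domain and
          \<open>w\<close> is continuous on each.\<close>
        define O' where "O' = \<Omega> - cball x0 (r / 2)"
        have "continuous_on (ball x0 r) (\<lambda>y. min (v n y) (q c y))"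
          unfolding q_def
          by (intro continuous_intros continuous_on_subset[OF supersolsD(1)[OF v] ball_dom])
        then have 1: "continuous_on (ball x0 r) w"
          by (rule continuous_on_eq) (simp add: w_def dist_commute)
        have "continuous_on O' (v n)"
          by (rule continuous_on_subset[OF supersolsD(1)[OF v]]) (simp add: O'_def)
        then have 2: "continuous_on O' w"
          by (rule continuous_on_eq) (simp add: w_outer O'_def dist_commute)
        have "open O'" unfolding O'_def using open_dom by (intro open_Diff) auto
        then have "continuous_on (ball x0 r \<union> O') w" using 1 2 by (intro continuous_on_open_Un) auto
        moreover have "\<Omega> = ball x0 r \<union> O'" using ball_dom r(1) by (auto simp: O'_def)
        ultimately show "continuous_on \<Omega> w" by simp
        fix y assume y: "y \<in> \<Omega>"
        show "0 \<le> w y"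
        proof (cases "dist y x0 < r")
          case True
          then have "0 \<le> q c y" using r2(2)[of y] r \<delta>(3) unfolding qc by simp
          then show ?thesis using supersolsD(2)[OF v y] by (simp add: w_def)
        qed (use supersolsD(2)[OF v y] in \<open>simp add: w_def\<close>)
        show "second_diff_le w y (- (\<mu> n * w y + g n))"
        proof (cases "w y = v n y")
          case True
          have "second_diff_le (v n) y (- (\<mu> n * w y + g n))"
            unfolding True by (rule supersolsD(3)[OF v y])
          moreover have "\<forall>\<^sub>F z in nhds y. w z \<le> v n z"
            by (intro always_eventually allI w_le)
          ultimately show ?thesis using True by (rule second_diff_le_touch)
        next
          case False
          then have yr: "dist y x0 < r" and wy: "w y = q c y"
            by (auto simp: w_def min_def split: if_splits)
          \<comment> \<open>Where the paraboloid is active, its second derivative - a meets the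
            demand of the supersolution condition: that demand is at most the one for
            \<open>v n\<close>, which lies within two halves of \<open>\<epsilon>\<close> of
            \<open>M * \<psi> x0\<close>.\<close>
          have "\<mu> n * w y + g n \<le> \<mu> n * v n y + g n" using w_le[of y] \<mu>[of n] by (simp add: mult_left_mono)
          also have "\<dots> < M * \<psi> y + \<epsilon> / 2" using n(2)[OF y] \<open>\<gamma> = 0\<close> by linarith
          also have "M * \<psi> y < M * \<psi> x0 + \<epsilon> / 2" using r2(2)[of y] yr r by simp
          also have "M * \<psi> x0 + \<epsilon> / 2 + \<epsilon> / 2 = a" unfolding a by simp
          finally have "- a \<le> - (\<mu> n * w y + g n)" by simp
          with second_diff_le_quadratic have "second_diff_le (q c) y (- (\<mu> n * w y + g n))"
            unfolding q_def by (rule second_diff_le_mono)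
          then show ?thesis
          proof (rule second_diff_le_touch)
            have "\<forall>\<^sub>F z in nhds y. z \<in> ball x0 r"
              using yr by (intro eventually_nhds_in_open) (auto simp: dist_commute)
            then show "\<forall>\<^sub>F z in nhds y. w z \<le> q c z"
              by eventually_elim (simp add: w_def dist_commute)
          qed (rule wy)
        qed
      qed
      \<comment> \<open>At the centre the cut lowers the function to at most
        \<open>\<psi> x0 - \<delta>\<close>, further than uniform convergence allows for the least
        supersolution \<open>v n\<close>.\<close>
      then have "v n x0 \<le> w x0" by (rule least[OF _ x0])
      also have "\<dots> \<le> \<psi> x0 - \<delta>" using r(1) by (simp add: w_def q_def c_def)
      finally show False using n(1)[OF x0] by linarith
    qed
  qed
  show ?thesis
    using \<psi>_cont \<psi>_bd pos cont super sub unfolding visc_solution_def M_def by blast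
qed

end

theorem theorem13:
  fixes \<Omega> :: "(real^'n) set"
  assumes "CARD('n) \<ge> 2"
    and "open \<Omega>" and "connected \<Omega>" and "\<Omega> \<noteq> {}"
    and "bounded \<Omega>" and "strictly_convex \<Omega>"
  shows "\<exists>\<psi>1 :: real^'n \<Rightarrow> real.
           continuous_on (closure \<Omega>) \<psi>1 \<and>
           visc_solution \<Omega> (mu1_plus \<Omega>) \<psi>1 \<and>
           (\<forall>x\<in>\<Omega>. \<psi>1 x > 0) \<and>
           (\<forall>x\<in>frontier \<Omega>. \<psi>1 x = 0)"
proof -
  interpret strictly_convex_domain \<Omega> by unfold_locales fact+
  show ?thesis by (rule eigenfunction_exists)
qed

end
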